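(* Let $\mathbf{x}:U\to\mathbb{R}^3$ be a proper frontal, $\mathbf{\Omega}$ a tangent moving basis of $\mathbf{x}$ and $p\in U$ a singularity. If the normal curvature has a smooth extension and the extension of the Gaussian curvature to $U$ is strictly negative, then there exist two families of curves (not necessarily regular) $\phi_1(t,q):J\times U_1\to U_2$, $\phi_2(t,q):J\times U_1\to U_2$, where $J$ is an open interval containing $0$ and $U_1,U_2$ are open sets of $\mathbb{R}^2$ with $p\in U_1\subset U_2\subset U$, satisfying the following: (i) $\phi_1$ and $\phi_2$ are smooth and $\phi_1(0,q)=\phi_2(0,q)=q$; (ii) for each fixed $q$, $t\mapsto\phi_1(t,q)$ and $t\mapsto\phi_2(t,q)$ are G-asymptotic curves of $\mathbf{x}$; (iii) for every $t_0\in J$ such that $\phi_i(t_0,q)\in\Sigma(\mathbf{x})^c$, we have $\phi_i'(t_0,q)\neq0$; and if $\phi_i(t_0,q)\in\Sigma(\mathbf{x})^c$ for $i=1,2$ simultaneously, then $\phi_1'(t_0,q)$ and $\phi_2'(t_0,q)$ are linearly independent. (Here $'$ is the derivative with respect to $t$.)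
   Context: All maps are $C^\infty$ and $U\subset\mathbb{R}^2$ is open. $D$ denotes the Jacobian matrix. A tangent moving basis (tmb) of $\mathbf{x}:U\to\mathbb{R}^3$ is a smooth map $\mathbf{\Omega}=(\mathbf{w}_1\ \mathbf{w}_2):U\to\mathcal{M}_{3\times2}(\mathbb{R})$ with columns linearly independent at every point and $\mathbf{x}_u,\mathbf{x}_v\in\mathrm{span}(\mathbf{w}_1,\mathbf{w}_2)$. The map $\mathbf{x}$ is a frontal if near each point there is a smooth unit vector field orthogonal to $\mathbf{x}_u,\mathbf{x}_v$; equivalently, tmbs exist locally, and a global tmb is always assumed. The normal field induced by $\mathbf{\Omega}$ is $\mathbf{n}=\frac{\mathbf{w}_1\times\mathbf{w}_2}{\|\mathbf{w}_1\times\mathbf{w}_2\|}$. $\Sigma(\mathbf{x})$ is the set of singularities, i.e. points where $\mathbf{x}$ is not immersive; the frontal is proper if $\Sigma(\mathbf{x})$ has empty interior. Set $\mathbf{I}=D\mathbf{x}^TD\mathbf{x}$, $\mathbf{II}=-D\mathbf{x}^TD\mathbf{n}$, $\mathbf{\Lambda}_\Omega=D\mathbf{x}^T\mathbf{\Omega}(\mathbf{\Omega}^T\mathbf{\Omega})^{-1}$. The Gaussian curvature on $\Sigma(\mathbf{x})^c$ is $K=\det\mathbf{II}/\det\mathbf{I}$. The normal curvature at $p\in\Sigma(\mathbf{x})^c$ is $k_p(\zeta)=\frac{\zeta^T\mathbf{II}\zeta}{\zeta^T\mathbf{I}\zeta}$, $\zeta\in\mathbb{R}^2-\{0\}$; it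 has a smooth extension if $(p,\omega)\mapsto k_p(\mathbf{\Lambda}_\Omega^{-T}\omega)$ on $\Sigma(\mathbf{x})^c\times(\mathbb{R}^2-\{0\})$ has a smooth extension to $U\times(\mathbb{R}^2-\{0\})$. In that case $K$ has a smooth extension to $U$. A smooth curve $\gamma:J\to U$ ($J$ an open interval) is a Gaussian asymptotic (G-asymptotic) curve of $\mathbf{x}$ if $\gamma'(t)^T\,\mathbf{II}(\gamma(t))\,\gamma'(t)=0$ for all $t$. *)

theory Defs
  imports "HOL-Analysis.Analysis"
begin

section \<open>Smooth maps\<close>

text \<open>
  Meant for open \<open>S\<close> and finite-dimensional domains, where it is the usual notion of
  \<open>C\<close>-\<open>n\<close>: all iterated directional derivatives up to order \<open>n\<close> exist and
  are continuous. Only the values of \<open>f\<close> on \<open>S\<close> matter when \<open>S\<close> is open.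
\<close>

primrec times_differentiable_on ::
    "nat \<Rightarrow> 'a::real_normed_vector set \<Rightarrow> ('a \<Rightarrow> 'b::real_normed_vector) \<Rightarrow> bool"
where
  "times_differentiable_on 0 S f \<longleftrightarrow> continuous_on S f"
| "times_differentiable_on (Suc n) S f \<longleftrightarrow>
     (\<forall>x\<in>S. f differentiable (at x)) \<and>
     (\<forall>v. times_differentiable_on n S (\<lambda>x. frechet_derivative f (at x) v))"

definition smooth_on ::
    "'a::real_normed_vector set \<Rightarrow> ('a \<Rightarrow> 'b::real_normed_vector) \<Rightarrow> bool"
where
  "smooth_on S f \<longleftrightarrow> (\<forall>n. times_differentiable_on n S f)"

definition smooth_extension ::
    "'a::real_normed_vector set \<Rightarrow> ('a \<Rightarrow> 'b::real_normed_vector) \<Rightarrow> 'a set \<Rightarrow> ('a \<Rightarrow> 'b) \<Rightarrow> bool"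
where
  "smooth_extension S f T F \<longleftrightarrow> S \<subseteq> T \<and> smooth_on T F \<and> (\<forall>x\<in>S. F x = f x)"

definition open_interval :: "real set \<Rightarrow> bool" where
  "open_interval J \<longleftrightarrow> open J \<and> is_interval J \<and> J \<noteq> {}"

text \<open>The disequality is needed because \<^const>\<open>independent\<close> is a predicate on sets.\<close>

definition lin_indep_pair :: "'a::real_vector \<Rightarrow> 'a \<Rightarrow> bool" where
  "lin_indep_pair a b \<longleftrightarrow> a \<noteq> b \<and> independent {a, b}"


section \<open>Frontals\<close>

abbreviation D :: "(real^2 \<Rightarrow> real^3) \<Rightarrow> real^2 \<Rightarrow> real^2^3" where
  "D f p \<equiv> jacobian f (at p)"

definition frontal :: "(real^2) set \<Rightarrow> (real^2 \<Rightarrow> real^3) \<Rightarrow> bool" where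
  "frontal U x \<longleftrightarrow> smooth_on U x \<and>
     (\<forall>p\<in>U. \<exists>V \<nu>. open V \<and> p \<in> V \<and> V \<subseteq> U \<and> smooth_on V (\<nu> :: real^2 \<Rightarrow> real^3) \<and>
        (\<forall>q\<in>V. norm (\<nu> q) = 1 \<and>
           orthogonal (\<nu> q) (column 1 (D x q)) \<and> orthogonal (\<nu> q) (column 2 (D x q))))"

definition tangent_moving_basis ::
    "(real^2) set \<Rightarrow> (real^2 \<Rightarrow> real^3) \<Rightarrow> (real^2 \<Rightarrow> real^2^3) \<Rightarrow> bool"
where
  "tangent_moving_basis U x \<Omega> \<longleftrightarrow> smooth_on U \<Omega> \<and>
     (\<forall>p\<in>U. lin_indep_pair (column 1 (\<Omega> p)) (column 2 (\<Omega> p)) \<and>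
        column 1 (D x p) \<in> span {column 1 (\<Omega> p), column 2 (\<Omega> p)} \<and>
        column 2 (D x p) \<in> span {column 1 (\<Omega> p), column 2 (\<Omega> p)})"

definition singularities :: "(real^2) set \<Rightarrow> (real^2 \<Rightarrow> real^3) \<Rightarrow> (real^2) set" where
  "singularities U x = {p \<in> U. \<not> inj (frechet_derivative x (at p))}"

text \<open>Complements of the singular set are taken in the domain \<open>U\<close>.\<close>

definition regular_points :: "(real^2) set \<Rightarrow> (real^2 \<Rightarrow> real^3) \<Rightarrow> (real^2) set" where
  "regular_points U x = U - singularities U x"

definition proper_frontal :: "(real^2) set \<Rightarrow> (real^2 \<Rightarrow> real^3) \<Rightarrow> bool" where
  "proper_frontal U x \<longleftrightarrow> frontal U x \<and> interior (singularities U x) = {}"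

definition normal_field :: "(real^2 \<Rightarrow> real^2^3) \<Rightarrow> real^2 \<Rightarrow> real^3" where
  "normal_field \<Omega> p =
     cross3 (column 1 (\<Omega> p)) (column 2 (\<Omega> p)) /\<^sub>R
       norm (cross3 (column 1 (\<Omega> p)) (column 2 (\<Omega> p)))"

definition first_form :: "(real^2 \<Rightarrow> real^3) \<Rightarrow> real^2 \<Rightarrow> real^2^2" where
  "first_form x p = transpose (D x p) ** D x p"

definition second_form ::
    "(real^2 \<Rightarrow> real^3) \<Rightarrow> (real^2 \<Rightarrow> real^2^3) \<Rightarrow> real^2 \<Rightarrow> real^2^2"
where
  "second_form x \<Omega> p = - (transpose (D x p) ** D (normal_field \<Omega>) p)"

definition Lambda ::
    "(real^2 \<Rightarrow> real^3) \<Rightarrow> (real^2 \<Rightarrow> real^2^3) \<Rightarrow> real^2 \<Rightarrow> real^2^2"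
where
  "Lambda x \<Omega> p =
     transpose (D x p) ** \<Omega> p ** matrix_inv (transpose (\<Omega> p) ** \<Omega> p)"

definition gauss_curvature ::
    "(real^2 \<Rightarrow> real^3) \<Rightarrow> (real^2 \<Rightarrow> real^2^3) \<Rightarrow> real^2 \<Rightarrow> real"
where
  "gauss_curvature x \<Omega> p = det (second_form x \<Omega> p) / det (first_form x p)"

definition normal_curvature ::
    "(real^2 \<Rightarrow> real^3) \<Rightarrow> (real^2 \<Rightarrow> real^2^3) \<Rightarrow> real^2 \<Rightarrow> real^2 \<Rightarrow> real"
where
  "normal_curvature x \<Omega> p \<zeta> =
     (\<zeta> \<bullet> (second_form x \<Omega> p *v \<zeta>)) / (\<zeta> \<bullet> (first_form x p *v \<zeta>))"

definition normal_curvature_extends ::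
    "(real^2) set \<Rightarrow> (real^2 \<Rightarrow> real^3) \<Rightarrow> (real^2 \<Rightarrow> real^2^3) \<Rightarrow> bool"
where
  "normal_curvature_extends U x \<Omega> \<longleftrightarrow>
     (\<exists>k. smooth_extension
            (regular_points U x \<times> (UNIV - {0}))
            (\<lambda>(p, \<omega>). normal_curvature x \<Omega> p (matrix_inv (transpose (Lambda x \<Omega> p)) *v \<omega>))
            (U \<times> (UNIV - {0})) k)"

definition G_asymptotic ::
    "(real^2) set \<Rightarrow> (real^2 \<Rightarrow> real^3) \<Rightarrow> (real^2 \<Rightarrow> real^2^3) \<Rightarrow> real set \<Rightarrow> (real \<Rightarrow> real^2) \<Rightarrow> bool"
where
  "G_asymptotic U x \<Omega> J \<gamma> \<longleftrightarrow>
     open_interval J \<and> smooth_on J \<gamma> \<and> \<gamma> ` J \<subseteq> U \<and>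
     (\<forall>t\<in>J. vector_derivative \<gamma> (at t) \<bullet>
              (second_form x \<Omega> (\<gamma> t) *v vector_derivative \<gamma> (at t)) = 0)"

end

theory Submission
  imports Defs
begin

text \<open>
  Write \<open>Dx = \<Omega> \<Lambda>\<^sup>T\<close> with the smooth matrix \<open>\<Lambda>\<close>; the singular points are the zeros of
  \<open>\<lambda> = det \<Lambda>\<close>. The smooth extension of the normal curvature says that, in the coordinates
  \<open>\<omega> = \<Lambda>\<^sup>T \<zeta>\<close>, the second fundamental form is a quadratic form
  \<open>a \<omega>\<^sub>1\<^sup>2 + 2 b \<omega>\<^sub>1 \<omega>\<^sub>2 + c \<omega>\<^sub>2\<^sup>2\<close> whose coefficients are smooth on all of \<open>U\<close>, singular points
  included. On regular points its discriminant \<open>b\<^sup>2 - a c\<close> is at least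
  \<open>- K det (\<Omega>\<^sup>T \<Omega>)\<close>; regular points are dense because the frontal is proper, so the inequality
  holds on \<open>U\<close> by continuity and the form is indefinite everywhere (\<open>asymptotic_form\<close>). Hence it
  has, near \<open>p\<close>, two smooth and independent fields \<open>w1\<close>, \<open>w2\<close> of null directions.

  A null direction \<open>w\<close> has to be pulled back to \<open>\<Lambda>\<^sup>-\<^sup>T w\<close>, which blows up at the singular points. The
  field \<open>v = adj(\<Lambda>)\<^sup>T w\<close> is smooth and satisfies \<open>\<Lambda>\<^sup>T v = \<lambda> w\<close>; its integral curves are already
  G-asymptotic. They do not suffice for the last claim, which compares the velocities of the two
  curves at two different points \<open>\<phi>1(t,q)\<close> and \<open>\<phi>2(t,q)\<close>: near \<open>\<Sigma>(x)\<close> the directions of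
  \<open>v1\<close> and \<open>v2\<close> may turn arbitrarily fast. The curves are therefore slowed down: \<open>\<phi>i\<close> is the flow of
  \<open>\<lambda> vi\<close>. This flow fixes singular points, and in a short time it moves a regular point \<open>q\<close> by at most a
  small multiple of \<open>\<bar>\<lambda>(q)\<bar>\<close> (\<open>slow_displacement\<close>). Since \<open>det (v1, v2) = \<lambda> det (w1, w2)\<close> is
  itself at least a constant multiple of \<open>\<bar>\<lambda>\<bar>\<close>, such a displacement cannot destroy independence
  (\<open>transversal_slow_flows\<close>).

  Most of the work is the smooth dependence of flows on initial values (\<open>local_smooth_flow\<close>). The
  time interval may be chosen as short as one likes, which replaces Gronwall's inequality by an
  elementary estimate. Smoothness follows by induction on the order of differentiability: the derivative of
  a solution with respect to parameters solves the linearized equation, whose right-hand side is one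
  order less smooth.
\<close>

section \<open>Calculus of C-n maps\<close>

abbreviation "td \<equiv> times_differentiable_on"

lemma td_subset: "td n S f \<Longrightarrow> T \<subseteq> S \<Longrightarrow> td n T f"
  by (induction n arbitrary: f) (auto intro: continuous_on_subset)

lemma td_imp_continuous_on: "td n S f \<Longrightarrow> continuous_on S f"
  by (cases n) (auto intro!: continuous_at_imp_continuous_on differentiable_imp_continuous_within)

lemma td_SucD: "td (Suc n) S f \<Longrightarrow> td n S f"
proof (induction n arbitrary: f)
  case 0
  then show ?case using td_imp_continuous_on by (metis times_differentiable_on.simps(1))
next
  case (Suc n)
  then show ?case by (metis times_differentiable_on.simps(2))
qed

lemma td_Suc_imp_td_1: "td (Suc n) S f \<Longrightarrow> td (Suc 0) S f"
  by (induction n) (use td_SucD in blast)+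

text \<open>
  \<^const>\<open>frechet_derivative\<close> is a choice among derivatives; it depends only on the germ of the map
  because having a given derivative does.
\<close>

lemma td_cong:
  assumes "open S" "\<And>x. x \<in> S \<Longrightarrow> f x = g x"
  shows "td n S f \<longleftrightarrow> td n S g"
  using assms(2)
proof (induction n arbitrary: f g)
  case 0
  then show ?case by (simp cong: continuous_on_cong)
next
  case (Suc n)
  have hd: "(f has_derivative D) (at x) \<longleftrightarrow> (g has_derivative D) (at x)" if "x \<in> S" for x D
    using has_derivative_transform_within_open[OF _ assms(1) that] Suc.prems by metis
  have "frechet_derivative f (at x) = frechet_derivative g (at x)" if "x \<in> S" for x
    using hd[OF that] by (simp add: frechet_derivative_def)
  then have "td n S (\<lambda>x. frechet_derivative f (at x) v) =
      td n S (\<lambda>x. frechet_derivative g (at x) v)" for v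
    by (intro Suc.IH) simp
  moreover have "f differentiable (at x) \<longleftrightarrow> g differentiable (at x)" if "x \<in> S" for x
    using hd[OF that] by (simp add: differentiable_def)
  ultimately show ?case by simp
qed

text \<open>
  The working form of the successor case: any explicit formula for the derivative on \<open>S\<close> will do.
\<close>

lemma td_SucI:
  assumes S: "open S" and f: "\<And>x. x \<in> S \<Longrightarrow> (f has_derivative f' x) (at x)"
    and f': "\<And>v. td n S (\<lambda>x. f' x v)"
  shows "td (Suc n) S f"
proof -
  have "frechet_derivative f (at x) = f' x" if "x \<in> S" for x
    using frechet_derivative_at[OF f[OF that]] by simp
  then have "td n S (\<lambda>x. frechet_derivative f (at x) v)" for v
    using f'[of v] td_cong[OF S, of "\<lambda>x. f' x v" "\<lambda>x. frechet_derivative f (at x) v"] by simp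
  then show ?thesis using f by (auto simp: differentiable_def)
qed

lemma td_SucE:
  assumes "td (Suc n) S f"
  shows "\<And>x. x \<in> S \<Longrightarrow> (f has_derivative frechet_derivative f (at x)) (at x)"
    and "\<And>v. td n S (\<lambda>x. frechet_derivative f (at x) v)"
  using assms by (auto simp: frechet_derivative_works[symmetric])

lemma td_bounded_linear:
  assumes S: "open S" and h: "bounded_linear h" and f: "td n S f"
  shows "td n S (\<lambda>x. h (f x))"
  using f
proof (induction n arbitrary: f)
  case 0
  then show ?case
    by (simp add: linear_continuous_on_compose bounded_linear.continuous_on[OF h])
next
  case (Suc n)
  note f = td_SucE[OF Suc.prems]
  show ?case
    by (rule td_SucI[OF S bounded_linear.has_derivative[OF h f(1)]]) (auto intro: Suc.IH f)
qed

lemma td_const: "open S \<Longrightarrow> td n S (\<lambda>x. c)"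
proof (induction n arbitrary: c)
  case (Suc n)
  show ?case
    by (rule td_SucI[OF Suc.prems has_derivative_const]) (rule Suc.IH[OF Suc.prems])
qed (simp add: continuous_on_const)

lemma td_id: "open S \<Longrightarrow> td n S (\<lambda>x. x)"
proof (cases n)
  case (Suc m)
  assume "open S"
  then show ?thesis unfolding Suc
    by (intro td_SucI[OF _ has_derivative_ident]) (auto intro: td_const)
qed (simp add: continuous_on_id)

lemma td_linear: "open S \<Longrightarrow> bounded_linear h \<Longrightarrow> td n S h"
  using td_bounded_linear[OF _ _ td_id] by blast

lemma td_add:
  assumes S: "open S" and "td n S f" "td n S g"
  shows "td n S (\<lambda>x. f x + g x)"
  using assms(2,3)
proof (induction n arbitrary: f g)
  case (Suc n)
  note fg = td_SucE[OF Suc.prems(1)] td_SucE[OF Suc.prems(2)]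
  show ?case
    by (rule td_SucI[OF S has_derivative_add[OF fg(1) fg(3)]]) (auto intro: Suc.IH fg)
qed (simp add: continuous_on_add)

lemma td_bilinear:
  assumes S: "open S" and p: "bounded_bilinear p" and "td n S f" "td n S g"
  shows "td n S (\<lambda>x. p (f x) (g x))"
  using assms(3,4)
proof (induction n arbitrary: f g)
  case 0
  then show ?case by (simp add: bounded_bilinear.continuous_on[OF p])
next
  case (Suc n)
  note fg = td_SucE[OF Suc.prems(1)] td_SucE[OF Suc.prems(2)]
  show ?case
    by (rule td_SucI[OF S bounded_bilinear.FDERIV[OF p fg(1) fg(3)]])
      (auto intro!: Suc.IH fg td_add[OF S] td_SucD[OF Suc.prems(1)] td_SucD[OF Suc.prems(2)])
qed

lemma td_sum:
  assumes "open S" "\<And>i. i \<in> A \<Longrightarrow> td n S (f i)"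
  shows "td n S (\<lambda>x. \<Sum>i\<in>A. f i x)"
  using assms(2)
  by (induction A rule: infinite_finite_induct) (auto intro!: td_const td_add assms(1))

lemma td_Pair:
  assumes S: "open S" and "td n S f" "td n S g"
  shows "td n S (\<lambda>x. (f x, g x))"
  using assms(2,3)
proof (induction n arbitrary: f g)
  case (Suc n)
  note fg = td_SucE[OF Suc.prems(1)] td_SucE[OF Suc.prems(2)]
  show ?case
    by (rule td_SucI[OF S has_derivative_Pair[OF fg(1) fg(3)]]) (auto intro: Suc.IH fg)
qed (simp add: continuous_on_Pair)

lemma linear_eq_sum_Basis:
  fixes h :: "'a::euclidean_space \<Rightarrow> 'b::real_vector"
  assumes "linear h"
  shows "h v = (\<Sum>b\<in>Basis. (v \<bullet> b) *\<^sub>R h b)"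
proof -
  have "h (\<Sum>b\<in>Basis. (v \<bullet> b) *\<^sub>R b) = (\<Sum>b\<in>Basis. (v \<bullet> b) *\<^sub>R h b)"
    using assms by (simp add: linear_sum linear_cmul)
  then show ?thesis by (simp add: euclidean_representation)
qed

text \<open>
  The chain rule alone does not close an induction, since its outer derivative is taken in a direction
  that varies with the point. Expanding that direction in a basis leaves a sum of products of maps that are
  one order less smooth.
\<close>

lemma td_compose:
  fixes f :: "'b::euclidean_space \<Rightarrow> 'c::real_normed_vector"
  assumes S: "open S" and gS: "\<And>x. x \<in> S \<Longrightarrow> g x \<in> T"
    and "td n T f" "td n S g"
  shows "td n S (\<lambda>x. f (g x))"
  using assms(3,4)
proof (induction n arbitrary: f)
  case 0
  then show ?case using gS by (auto intro: continuous_on_compose2)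
next
  case (Suc n)
  note f = td_SucE[OF Suc.prems(1)] and g = td_SucE[OF Suc.prems(2)]
  let ?f' = "\<lambda>x v. \<Sum>b\<in>Basis. (frechet_derivative g (at x) v \<bullet> b) *\<^sub>R frechet_derivative f (at (g x)) b"
  show ?case
  proof (rule td_SucI[OF S])
    fix x assume x: "x \<in> S"
    have "((\<lambda>x. f (g x)) has_derivative
        (\<lambda>v. frechet_derivative f (at (g x)) (frechet_derivative g (at x) v))) (at x)"
      by (rule has_derivative_compose[OF g(1)[OF x] f(1)[OF gS[OF x]]])
    moreover have "linear (frechet_derivative f (at (g x)))"
      using f(1)[OF gS[OF x]] has_derivative_linear by blast
    ultimately show "((\<lambda>x. f (g x)) has_derivative ?f' x) (at x)"
      by (subst (asm) linear_eq_sum_Basis)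
  next
    fix v
    have "td n S (\<lambda>x. frechet_derivative f (at (g x)) b)" for b
      by (rule Suc.IH[OF f(2) td_SucD[OF Suc.prems(2)]])
    then show "td n S (\<lambda>x. ?f' x v)"
      by (intro td_sum[OF S] td_bilinear[OF S bounded_bilinear_scaleR]
          td_bounded_linear[OF S bounded_linear_inner_left] g)
  qed
qed

lemma td_minus: "open S \<Longrightarrow> td n S f \<Longrightarrow> td n S (\<lambda>x. - f x)"
  by (rule td_bounded_linear[OF _ bounded_linear_minus[OF bounded_linear_ident]])

lemma td_diff: "open S \<Longrightarrow> td n S f \<Longrightarrow> td n S g \<Longrightarrow> td n S (\<lambda>x. f x - g x)"
  using td_add[OF _ _ td_minus, of S n f g] by simp

lemma td_mult:
  fixes f g :: "_ \<Rightarrow> real"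
  shows "open S \<Longrightarrow> td n S f \<Longrightarrow> td n S g \<Longrightarrow> td n S (\<lambda>x. f x * g x)"
  by (rule td_bilinear[OF _ bounded_bilinear_mult])

lemma td_real_inverse: "td n (- {0}) (inverse :: real \<Rightarrow> real)"
proof (induction n)
  case 0
  then show ?case by (auto intro!: continuous_intros)
next
  case (Suc n)
  have o: "open (- {0::real})" by auto
  show ?case
    by (rule td_SucI[OF o has_derivative_inverse'])
      (auto intro!: td_minus td_mult Suc td_const o)
qed

lemma td_real_sqrt: "td n {0<..} sqrt"
proof (induction n)
  case 0
  then show ?case by (auto intro!: continuous_intros)
next
  case (Suc n)
  have o: "open {0::real<..}" by auto
  have "td n {0<..} (\<lambda>x. inverse (sqrt x))"
    by (rule td_compose[OF o _ td_real_inverse Suc]) auto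
  then have "td n {0<..} (\<lambda>x. v * inverse (sqrt x) / 2)" for v
    using td_mult[OF o td_const[OF o, of n "v / 2"]] by simp
  moreover have "(sqrt has_derivative (\<lambda>v. v * inverse (sqrt x) / 2)) (at x)"
    if "x \<in> {0<..}" for x
    using that by (auto intro!: derivative_eq_intros)
  ultimately show ?case by (intro td_SucI[OF o])
qed

lemma td_inverse:
  fixes f :: "_ \<Rightarrow> real"
  assumes "open S" "\<And>x. x \<in> S \<Longrightarrow> f x \<noteq> 0" "td n S f"
  shows "td n S (\<lambda>x. inverse (f x))"
  by (rule td_compose[OF assms(1) _ td_real_inverse assms(3)]) (use assms(2) in auto)

lemma td_sqrt:
  assumes "open S" "\<And>x. x \<in> S \<Longrightarrow> f x > 0" "td n S f"
  shows "td n S (\<lambda>x. sqrt (f x))"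
  by (rule td_compose[OF assms(1) _ td_real_sqrt assms(3)]) (use assms(2) in auto)

lemma td_vec_nth: "open S \<Longrightarrow> td n S f \<Longrightarrow> td n S (\<lambda>x. f x $ i)"
  by (rule td_bounded_linear[OF _ bounded_linear_vec_nth])

lemma td_vector2:
  fixes f g :: "_ \<Rightarrow> real"
  assumes S: "open S" and f: "td n S f" and g: "td n S g"
  shows "td n S (\<lambda>x. vector [f x, g x] :: real^2)"
proof -
  have "vector [a, b] = a *\<^sub>R axis 1 1 + b *\<^sub>R (axis 2 1 :: real^2)" for a b :: real
    by (simp add: vec_eq_iff forall_2 axis_def)
  then show ?thesis
    by (simp add: td_add[OF S] td_bilinear[OF S bounded_bilinear_scaleR] td_const[OF S] f g)
qed

text \<open>
  In finite dimensions, continuity of all directional derivatives is continuity of the derivative in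
  operator norm.
\<close>

lemma td_continuous_frechet_blinfun:
  fixes f :: "'a::euclidean_space \<Rightarrow> 'b::real_normed_vector"
  assumes "td (Suc n) S f"
  shows "continuous_on S (\<lambda>x. Blinfun (frechet_derivative f (at x)))"
    and "\<And>x. x \<in> S \<Longrightarrow> blinfun_apply (Blinfun (frechet_derivative f (at x))) = frechet_derivative f (at x)"
proof -
  note f = td_SucE[OF assms]
  show *: "blinfun_apply (Blinfun (frechet_derivative f (at x))) = frechet_derivative f (at x)"
    if "x \<in> S" for x
    using f(1)[OF that] has_derivative_bounded_linear bounded_linear_Blinfun_apply by blast
  show "continuous_on S (\<lambda>x. Blinfun (frechet_derivative f (at x)))"
  proof (rule continuous_on_blinfun_componentwise)
    fix i :: 'a
    have "continuous_on S (\<lambda>x. frechet_derivative f (at x) i)"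
      using f(2) td_imp_continuous_on by blast
    then show "continuous_on S (\<lambda>x. blinfun_apply (Blinfun (frechet_derivative f (at x))) i)"
      using * by (simp cong: continuous_on_cong)
  qed
qed

lemma td_Lipschitz_cball:
  fixes f :: "'a::euclidean_space \<Rightarrow> 'b::real_normed_vector"
  assumes "td (Suc 0) S f" "cball p r \<subseteq> S"
  obtains L where "L \<ge> 0" "\<And>x y. x \<in> cball p r \<Longrightarrow> y \<in> cball p r \<Longrightarrow> norm (f x - f y) \<le> L * norm (x - y)"
proof -
  note c = td_continuous_frechet_blinfun[OF assms(1)]
  have "compact ((\<lambda>x. Blinfun (frechet_derivative f (at x))) ` cball p r)"
    using c(1) assms(2) continuous_on_subset compact_continuous_image compact_cball by blast
  then obtain L where L: "\<And>x. x \<in> cball p r \<Longrightarrow> norm (Blinfun (frechet_derivative f (at x))) \<le> L" "L > 0"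
    using compact_imp_bounded bounded_pos by (smt (verit) imageI)
  have "norm (f x - f y) \<le> L * norm (x - y)" if "x \<in> cball p r" "y \<in> cball p r" for x y
  proof (rule differentiable_bound[OF convex_cball _ _ that])
    fix z assume z: "z \<in> cball p r"
    show "(f has_derivative frechet_derivative f (at z)) (at z within cball p r)"
      using td_SucE(1)[OF assms(1)] z assms(2) has_derivative_at_withinI by blast
    show "onorm (frechet_derivative f (at z)) \<le> L"
      using L(1)[OF z] c(2) z assms(2) by (auto simp: norm_blinfun.rep_eq)
  qed
  then show thesis using that L(2) by (meson less_imp_le)
qed

section \<open>Short-time estimates and existence for differential equations\<close>

lemma onorm_scaleR_le: "onorm (\<lambda>h::real. h *\<^sub>R v) \<le> B" if "norm v \<le> B"
  using that by (intro onorm_le) (simp add: mult.commute[of B] mult_left_mono)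

text \<open>
  A substitute for Gronwall's inequality: over a time \<open>T \<le> 1 / (2 L)\<close> the mean value theorem at a
  maximum \<open>m\<close> of \<open>norm \<circ> u\<close> bounds the growth by half of \<open>norm (u m)\<close>, which is absorbed on the left.
\<close>

lemma norm_le_short_time:
  fixes u :: "real \<Rightarrow> 'b::real_normed_vector"
  assumes T: "0 \<le> T" and TL: "T * L \<le> 1/2"
    and u: "\<And>t. t \<in> {-T..T} \<Longrightarrow> (u has_vector_derivative u' t) (at t within {-T..T})"
    and u': "\<And>t. t \<in> {-T..T} \<Longrightarrow> norm (u' t) \<le> L * norm (u t) + b"
    and L: "0 \<le> L" and t: "t \<in> {-T..T}"
  shows "norm (u t) \<le> 2 * (norm (u 0) + T * b)"
proof -
  have "continuous_on {-T..T} u"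
    using u by (intro continuous_on_vector_derivative)
  then have "continuous_on {-T..T} (\<lambda>t. norm (u t))"
    by (intro continuous_intros)
  then obtain m where m: "m \<in> {-T..T}" "\<And>t. t \<in> {-T..T} \<Longrightarrow> norm (u t) \<le> norm (u m)"
    using continuous_attains_sup[of "{-T..T}" "\<lambda>t. norm (u t)"] T by auto
  define B where "B = L * norm (u m) + b"
  have B: "norm (u' t) \<le> B" if "t \<in> {-T..T}" for t
    using u'[OF that] mult_left_mono[OF m(2)[OF that] L] unfolding B_def by linarith
  then have "B \<ge> 0" using m(1) norm_ge_zero order_trans by blast
  have "norm (u m - u 0) \<le> B * norm (m - 0)"
  proof (rule differentiable_bound[of "{-T..T}" u "\<lambda>t h. h *\<^sub>R u' t" B])
    show "onorm (\<lambda>h. h *\<^sub>R u' t) \<le> B" if "t \<in> {-T..T}" for t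
      using B[OF that] by (rule onorm_scaleR_le)
  qed (use u T m in \<open>auto simp: has_vector_derivative_def\<close>)
  also have "\<dots> \<le> B * T"
    using m(1) \<open>B \<ge> 0\<close> by (intro mult_left_mono) auto
  also have "\<dots> = (T * L) * norm (u m) + T * b"
    by (simp add: B_def algebra_simps)
  also have "\<dots> \<le> 1/2 * norm (u m) + T * b"
    using mult_right_mono[OF TL norm_ge_zero[of "u m"]] by linarith
  finally have "norm (u m) \<le> 2 * (norm (u 0) + T * b)"
    using norm_triangle_sub[of "u m" "u 0"] unfolding distrib_left by linarith
  then show ?thesis using m(2)[OF t] by linarith
qed

text \<open>
  For \<open>T L \<le> 1/2\<close> the Picard operator is a contraction for the plain supremum norm. Functions on
  \<open>{-T..T}\<close> are represented by bounded continuous functions on the line, frozen outside the interval.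
\<close>

lemma picard_short_time:
  fixes f :: "real \<Rightarrow> 'b::euclidean_space \<Rightarrow> 'b"
  assumes T: "0 < T" and L: "0 \<le> L" and TL: "T * L \<le> 1/2"
    and cont: "continuous_on ({-T..T} \<times> UNIV) (\<lambda>(t, y). f t y)"
    and lip: "\<And>t y z. t \<in> {-T..T} \<Longrightarrow> norm (f t y - f t z) \<le> L * norm (y - z)"
  shows "\<exists>y. y 0 = y0 \<and> (\<forall>t\<in>{-T..T}. (y has_vector_derivative f t (y t)) (at t within {-T..T}))"
proof -
  define G where "G y t = y0 + (integral {-T..t} (\<lambda>s. f s (y s)) - integral {-T..0} (\<lambda>s. f s (y s)))"
    for y :: "real \<Rightarrow> 'b" and t
  define cl where "cl t = max (-T) (min T t)" for t
  have cl: "cl t \<in> {-T..T}" "continuous_on S cl" "t \<in> {-T..T} \<Longrightarrow> cl t = t" for t S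
    unfolding cl_def using T by (auto intro!: continuous_intros)
  define P where "P y = Bcontfun (\<lambda>t. G (apply_bcontfun y) (cl t))" for y
  have G: "(G y has_vector_derivative f t (y t)) (at t within {-T..T})"
    if "continuous_on UNIV y" "t \<in> {-T..T}" for y t
  proof -
    have "continuous_on {-T..T} (\<lambda>s. f s (y s))"
      using continuous_on_compose2[OF cont, of "{-T..T}" "\<lambda>s. (s, y s)"]
        continuous_on_subset[OF that(1), of "{-T..T}"] by (simp add: continuous_on_Pair image_subset_iff)
    note integral_has_vector_derivative[OF this that(2)]
    then show ?thesis unfolding G_def by (auto intro!: derivative_eq_intros)
  qed
  have Gc: "continuous_on {-T..T} (G y)" if "continuous_on UNIV y" for y
    using G[OF that] by (intro continuous_on_vector_derivative)
  have P: "apply_bcontfun (P y) t = G (apply_bcontfun y) (cl t)" for y t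
  proof -
    let ?g = "\<lambda>t. G (apply_bcontfun y) (cl t)"
    have "continuous_on UNIV ?g"
      by (rule continuous_on_compose2[OF Gc cl(2)]) (use cl(1) in auto)
    moreover have "bounded (range ?g)"
    proof (rule bounded_subset)
      show "bounded (G (apply_bcontfun y) ` {-T..T})"
        by (intro compact_imp_bounded compact_continuous_image Gc compact_Icc continuous_on_apply_bcontfun)
    qed (use cl(1) in auto)
    ultimately have "?g \<in> bcontfun" by (simp add: bcontfun_def)
    then show ?thesis unfolding P_def by (simp add: Bcontfun_inverse)
  qed
  have G0: "G y 0 = y0" for y by (simp add: G_def)
  have "dist (P y) (P z) \<le> 1/2 * dist y z" for y z
  proof (rule dist_bound)
    fix t
    have "norm ((G y (cl t) - G z (cl t)) - (G y 0 - G z 0)) \<le> (L * dist y z) * norm (cl t - 0)"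
    proof (rule differentiable_bound[of "{-T..T}" "\<lambda>t. G y t - G z t"
          "\<lambda>t h. h *\<^sub>R (f t (y t) - f t (z t))" "L * dist y z"])
      fix s assume s: "s \<in> {-T..T}"
      have "((\<lambda>t. G y t - G z t) has_vector_derivative (f s (y s) - f s (z s))) (at s within {-T..T})"
        by (intro has_vector_derivative_diff G s continuous_on_apply_bcontfun)
      then show "((\<lambda>t. G y t - G z t) has_derivative (\<lambda>h. h *\<^sub>R (f s (y s) - f s (z s)))) (at s within {-T..T})"
        by (simp add: has_vector_derivative_def)
      have "norm (f s (y s) - f s (z s)) \<le> L * norm (y s - z s)"
        by (rule lip[OF s])
      also have "\<dots> \<le> L * dist y z"
        using dist_bounded[of y s z] L by (intro mult_left_mono) (auto simp: dist_norm)
      finally show "onorm (\<lambda>h. h *\<^sub>R (f s (y s) - f s (z s))) \<le> L * dist y z"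
        by (rule onorm_scaleR_le)
    qed (use cl(1)[of t] T in auto)
    also have "\<dots> \<le> (L * dist y z) * T"
      using cl(1)[of t] L by (intro mult_left_mono) auto
    also have "\<dots> \<le> 1/2 * dist y z"
      using mult_right_mono[OF TL zero_le_dist[of y z]] by (simp add: algebra_simps)
    finally show "dist (P y t) (P z t) \<le> 1/2 * dist y z"
      by (simp add: P G0 dist_norm)
  qed
  then obtain y where y: "P y = y"
    using banach_fix_type[of "1/2" P] by auto
  have yG: "apply_bcontfun y t = G (apply_bcontfun y) t" if "t \<in> {-T..T}" for t
    using P[of y t] cl(3)[OF that] y by simp
  show ?thesis
  proof (intro exI[of _ "apply_bcontfun y"] conjI ballI)
    show "apply_bcontfun y 0 = y0" using yG[of 0] T G0 by simp
    show "(apply_bcontfun y has_vector_derivative f t (y t)) (at t within {-T..T})"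
      if "t \<in> {-T..T}" for t
      by (rule has_vector_derivative_transform[OF that _ G[OF _ that]]) (auto simp: yG)
  qed
qed

text \<open>
  First-order expansions of a C-1 map are uniform along a compact set: the derivative is continuous in
  operator norm, hence uniformly so near the compact set.
\<close>

lemma uniform_differentiability:
  fixes F :: "'a::euclidean_space \<Rightarrow> 'b::real_normed_vector"
  assumes F: "td (Suc 0) S F" and S: "open S" and K: "compact K" "K \<subseteq> S" and \<eta>: "\<eta> > 0"
  obtains \<delta> where "\<delta> > 0"
    and "\<And>x k. x \<in> K \<Longrightarrow> norm k < \<delta> \<Longrightarrow> x + k \<in> S"
    and "\<And>x k. x \<in> K \<Longrightarrow> norm k < \<delta> \<Longrightarrow>
          norm (F (x + k) - F x - frechet_derivative F (at x) k) \<le> \<eta> * norm k"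
proof -
  let ?D = "\<lambda>x. frechet_derivative F (at x)" and ?A = "\<lambda>x. Blinfun (frechet_derivative F (at x))"
  note A = td_continuous_frechet_blinfun[OF F]
  obtain \<epsilon> where \<epsilon>: "\<epsilon> > 0" "(\<Union>x\<in>K. ball x \<epsilon>) \<subseteq> S"
    using compact_subset_open_imp_ball_epsilon_subset[OF K(1) S K(2)] .
  have xkS: "x + k \<in> S" if "x \<in> K" "norm k < \<epsilon>" for x k
    using \<epsilon>(2) that by (auto simp: subset_eq dist_norm)
  have "continuous_on (ball 0 \<epsilon> \<times> K) (\<lambda>z. ?A (snd z + fst z))"
    by (rule continuous_on_compose2[OF A(1)]) (auto intro!: continuous_intros xkS)
  from continuous_on_prod_compactE[OF this K(1) _ \<eta>, of 0]
  obtain X :: "'a set" where X: "0 \<in> X" "open X" and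
    "\<forall>k\<in>X \<inter> ball 0 \<epsilon>. \<forall>x\<in>K. dist (?A (snd (k, x) + fst (k, x))) (?A (snd (0::'a, x) + fst (0, x))) \<le> \<eta>"
    using \<epsilon>(1) by (metis centre_in_ball)
  then have X3: "dist (?A (x + k)) (?A x) \<le> \<eta>" if "k \<in> X \<inter> ball 0 \<epsilon>" "x \<in> K" for k x :: 'a
    using that by fastforce
  obtain \<delta>0 where "\<delta>0 > 0" "ball 0 \<delta>0 \<subseteq> X" using X(1,2) open_contains_ball by blast
  define \<delta> where "\<delta> = min \<delta>0 \<epsilon>"
  have \<delta>: "\<delta> > 0" "ball 0 \<delta> \<subseteq> X" "\<delta> \<le> \<epsilon>"
    using \<open>\<delta>0 > 0\<close> \<epsilon>(1) \<open>ball 0 \<delta>0 \<subseteq> X\<close> unfolding \<delta>_def by auto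
  show thesis
  proof
    show "\<delta> > 0" by fact
    show "x + k \<in> S" if "x \<in> K" "norm k < \<delta>" for x k
      using xkS that \<delta>(3) by auto
    fix x k :: 'a assume x: "x \<in> K" and k: "norm k < \<delta>"
    have bS: "y \<in> S" if "y \<in> ball x \<delta>" for y
      using xkS[OF x, of "y - x"] that \<delta>(3) by (auto simp: dist_norm norm_minus_commute)
    have "norm (F (x + k) - F x - ?D x (x + k - x)) \<le> norm (x + k - x) * \<eta>"
    proof (rule differentiable_bound_linearization[where S="ball x \<delta>"])
      show "x + t *\<^sub>R (x + k - x) \<in> ball x \<delta>" if "t \<in> {0..1}" for t :: real
      proof -
        have "\<bar>t\<bar> * norm k \<le> 1 * norm k" using that by (intro mult_right_mono) auto
        then show ?thesis using k by (simp add: dist_norm)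
      qed
      fix y assume y: "y \<in> ball x \<delta>"
      show "(F has_derivative ?D y) (at y within ball x \<delta>)"
        using td_SucE(1)[OF F bS[OF y]] has_derivative_at_withinI by blast
      have "y - x \<in> X \<inter> ball 0 \<epsilon>"
        using y \<delta> by (auto simp: dist_norm norm_minus_commute)
      from X3[OF this x] have "norm (?A y - ?A x) \<le> \<eta>"
        by (simp add: dist_norm)
      moreover have "blinfun_apply (?A y - ?A x) = ?D y - ?D x"
        using A(2)[OF bS[OF y]] A(2)[of x] x K(2) by (simp add: fun_eq_iff minus_blinfun.rep_eq subset_iff)
      ultimately show "onorm (?D y - ?D x) \<le> \<eta>"
        by (simp add: norm_blinfun.rep_eq)
    qed (use \<delta> in auto)
    then show "norm (F (x + k) - F x - ?D x k) \<le> \<eta> * norm k"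
      by (simp add: mult.commute)
  qed
qed

text \<open>
  For a short step \<open>s w\<close> in the second variable, the increment of \<open>F\<close> is both at most
  \<open>L norm (s w)\<close> and close to the derivative applied to the step.
\<close>

lemma norm_frechet_derivative_le_Lipschitz:
  fixes F :: "'c::euclidean_space \<times> 'b::euclidean_space \<Rightarrow> 'd::real_normed_vector"
  assumes F: "td (Suc 0) (S \<times> Om) F" and o: "open S" "open Om"
    and lip: "\<And>r y z. r \<in> S \<Longrightarrow> y \<in> Om \<Longrightarrow> z \<in> Om \<Longrightarrow> norm (F (r, y) - F (r, z)) \<le> L * norm (y - z)"
    and ry: "r \<in> S" "y \<in> Om"
  shows "norm (frechet_derivative F (at (r, y)) (0, w)) \<le> L * norm w"
proof (cases "w = 0")
  case True
  have "linear (frechet_derivative F (at (r, y)))"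
    using td_SucE(1)[OF F, of "(r, y)"] ry has_derivative_linear by auto
  then show ?thesis using True linear_0 by (fastforce simp: zero_prod_def[symmetric])
next
  case False
  let ?D = "frechet_derivative F (at (r, y))"
  have lin: "linear ?D"
    using td_SucE(1)[OF F, of "(r, y)"] ry has_derivative_linear by auto
  have "norm (?D (0, w)) \<le> L * norm w + \<eta>" if \<eta>: "\<eta> > 0" for \<eta>
  proof -
    have "\<eta> / norm w > 0" using \<eta> False by simp
    then obtain \<delta> where \<delta>: "\<delta> > 0"
      "\<And>k. norm k < \<delta> \<Longrightarrow> (r, y) + k \<in> S \<times> Om"
      "\<And>k. norm k < \<delta> \<Longrightarrow> norm (F ((r, y) + k) - F (r, y) - ?D k) \<le> \<eta> / norm w * norm k"
      using uniform_differentiability[OF F open_Times[OF o], of "{(r, y)}" "\<eta> / norm w"] ry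
      by (metis compact_sing empty_subsetI insert_subset mem_Times_iff fst_conv snd_conv insertI1)
    \<comment> \<open>A step along \<open>w\<close> of half the length allowed by \<open>\<delta>\<close>.\<close>
    define s where "s = \<delta> / (2 * norm w)"
    have s: "s > 0" using \<delta>(1) False by (simp add: s_def)
    have k: "norm (0 :: 'c, s *\<^sub>R w) = s * norm w" using s by (simp add: norm_Pair)
    have ks: "norm (0 :: 'c, s *\<^sub>R w) < \<delta>" unfolding k using \<delta>(1) False by (simp add: s_def)
    have "norm (F ((r, y) + (0, s *\<^sub>R w)) - F (r, y)) \<le> L * norm (s *\<^sub>R w)"
      using lip[OF ry(1), of "y + s *\<^sub>R w" y] \<delta>(2)[OF ks] ry by simp
    moreover have "?D (0, s *\<^sub>R w) = s *\<^sub>R ?D (0, w)"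
      using linear_cmul[OF lin, of s "(0, w)"] by simp
    ultimately have "norm (s *\<^sub>R ?D (0, w)) \<le> L * norm (s *\<^sub>R w) + \<eta> / norm w * (s * norm w)"
      using \<delta>(3)[OF ks] norm_triangle_ineq3[of "F ((r, y) + (0, s *\<^sub>R w)) - F (r, y)" "?D (0, s *\<^sub>R w)"]
      unfolding k by simp
    then have "s * norm (?D (0, w)) \<le> s * (L * norm w + \<eta>)"
      using s False by (simp add: algebra_simps)
    then show ?thesis using s by simp
  qed
  then show ?thesis by (rule field_le_epsilon)
qed

section \<open>Smooth dependence on parameters\<close>

text \<open>
  \<open>Y t q\<close> solves \<open>y' = F ((t, q), y)\<close>, with parameter \<open>q\<close>, on a time interval short compared with the
  Lipschitz constant of \<open>F\<close>; the initial value \<open>Y 0 q\<close> may depend on \<open>q\<close>. This class is closed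
  under differentiation with respect to \<open>q\<close>, with the same interval and Lipschitz constant, and so
  admits an induction on smoothness. The bound \<open>1/4\<close>, instead of the \<open>1/2\<close> of the estimates above,
  leaves room for an error term in the proof of differentiability.
\<close>

locale short_time_ode =
  fixes e L :: real and V :: "'a::euclidean_space set" and Om :: "'b::euclidean_space set"
    and F :: "(real \<times> 'a) \<times> 'b \<Rightarrow> 'b" and Y :: "real \<Rightarrow> 'a \<Rightarrow> 'b"
  assumes e: "e > 0" and L: "L \<ge> 0" and eL: "e * L \<le> 1/4"
    and open_V: "open V" and open_Om: "open Om"
    and Lipschitz: "\<And>t q y z. t \<in> {-e<..<e} \<Longrightarrow> q \<in> V \<Longrightarrow> y \<in> Om \<Longrightarrow> z \<in> Om \<Longrightarrow>
          norm (F ((t, q), y) - F ((t, q), z)) \<le> L * norm (y - z)"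
    and Y_in: "\<And>t q. t \<in> {-e<..<e} \<Longrightarrow> q \<in> V \<Longrightarrow> Y t q \<in> Om"
    and ode: "\<And>t q. t \<in> {-e<..<e} \<Longrightarrow> q \<in> V \<Longrightarrow>
          ((\<lambda>t. Y t q) has_vector_derivative F ((t, q), Y t q)) (at t)"
begin

lemma short_time: "0 < T \<Longrightarrow> T < e \<Longrightarrow> T * L \<le> 1/4"
  using mult_right_mono[of T e L] L eL by linarith

lemma ode_within: "T < e \<Longrightarrow> t \<in> {-T..T} \<Longrightarrow> q \<in> V \<Longrightarrow>
    ((\<lambda>t. Y t q) has_vector_derivative F ((t, q), Y t q)) (at t within {-T..T})"
  using ode[of t q] has_vector_derivative_at_within by fastforce

lemma continuous_in_time: "q \<in> V \<Longrightarrow> continuous_on {-e<..<e} (\<lambda>t. Y t q)"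
  by (rule continuous_on_vector_derivative, rule has_vector_derivative_at_within) (rule ode)

text \<open>
  The solutions for \<open>q\<close> and \<open>q0\<close> have nearby initial values, and along the compact curve \<open>Y t q0\<close>
  their equations are uniformly close.
\<close>

lemma uniformly_continuous_in_parameter:
  assumes F: "continuous_on (({-e<..<e} \<times> V) \<times> Om) F" and Y0: "continuous_on V (Y 0)"
    and q0: "q0 \<in> V" and T: "0 < T" "T < e" and \<eta>: "\<eta> > 0"
  shows "\<exists>d>0. ball q0 d \<subseteq> V \<and> (\<forall>q\<in>ball q0 d. \<forall>t\<in>{-T..T}. norm (Y t q - Y t q0) \<le> \<eta>)"
proof -
  define \<eta>' where "\<eta>' = \<eta> / (2 * (1 + T))"
  have \<eta>': "\<eta>' > 0" "2 * (\<eta>' + T * \<eta>') = \<eta>"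
  proof -
    show "\<eta>' > 0" using \<eta> T by (simp add: \<eta>'_def)
    have "2 * (\<eta>' + T * \<eta>') = \<eta>' * (2 * (1 + T))" by (simp add: algebra_simps)
    also have "\<dots> = \<eta>" unfolding \<eta>'_def using T by simp
    finally show "2 * (\<eta>' + T * \<eta>') = \<eta>" .
  qed
  have J: "t \<in> {-e<..<e}" if "t \<in> {-T..T}" for t using that T by auto
  have "continuous_on {-T..T} (\<lambda>t. Y t q0)"
    using continuous_on_subset[OF continuous_in_time[OF q0]] J by blast
  then have "continuous_on (V \<times> {-T..T}) (\<lambda>z. Y (snd z) q0)"
    by (rule continuous_on_compose2) (auto intro!: continuous_intros)
  then have "continuous_on (V \<times> {-T..T}) (\<lambda>z. F ((snd z, fst z), Y (snd z) q0))"
    using T by (intro continuous_on_compose2[OF F] continuous_intros) (auto intro!: Y_in q0)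
  from continuous_on_prod_compactE[OF this compact_Icc q0 \<eta>'(1)]
  obtain X :: "'a set" where X: "q0 \<in> X" "open X" and
    "\<forall>q\<in>X \<inter> V. \<forall>t\<in>{-T..T}. dist (F ((snd (q, t), fst (q, t)), Y (snd (q, t)) q0))
        (F ((snd (q0, t), fst (q0, t)), Y (snd (q0, t)) q0)) \<le> \<eta>'" .
  then have X3: "norm (F ((t, q), Y t q0) - F ((t, q0), Y t q0)) \<le> \<eta>'"
    if "q \<in> X" "q \<in> V" "t \<in> {-T..T}" for t q
    using that by (auto simp: dist_norm)
  obtain d1 where d1: "d1 > 0" "\<And>q. q \<in> V \<Longrightarrow> dist q q0 < d1 \<Longrightarrow> dist (Y 0 q) (Y 0 q0) < \<eta>'"
    using Y0 q0 \<eta>'(1) unfolding continuous_on_iff by blast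
  obtain d2 where d2: "d2 > 0" "ball q0 d2 \<subseteq> X \<inter> V"
    using X q0 open_V open_contains_ball by (metis IntI open_Int)
  show ?thesis
  proof (intro exI[of _ "min d1 d2"] conjI ballI)
    show "min d1 d2 > 0" "ball q0 (min d1 d2) \<subseteq> V" using d1 d2 by auto
    fix q t assume q: "q \<in> ball q0 (min d1 d2)" and t: "t \<in> {-T..T}"
    have qV: "q \<in> V" "q \<in> X" using q d2(2) by auto
    have "norm (Y t q - Y t q0) \<le> 2 * (norm (Y 0 q - Y 0 q0) + T * \<eta>')"
    proof (rule norm_le_short_time[where L=L, OF _ _ _ _ L t])
      fix s assume s: "s \<in> {-T..T}"
      show "((\<lambda>t. Y t q - Y t q0) has_vector_derivative F ((s, q), Y s q) - F ((s, q0), Y s q0))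
          (at s within {-T..T})"
        by (intro has_vector_derivative_diff ode_within s T qV q0)
      have "norm (F ((s, q), Y s q) - F ((s, q), Y s q0)) \<le> L * norm (Y s q - Y s q0)"
        by (intro Lipschitz Y_in J s qV q0)
      then show "norm (F ((s, q), Y s q) - F ((s, q0), Y s q0)) \<le> L * norm (Y s q - Y s q0) + \<eta>'"
        using X3[OF qV(2,1) s] by (rule norm_diff_triangle_le)
    qed (use T short_time[OF T] in linarith)+
    also have "\<dots> \<le> 2 * (\<eta>' + T * \<eta>')"
      using d1(2)[OF qV(1)] q by (auto simp: dist_norm norm_minus_commute)
    finally show "norm (Y t q - Y t q0) \<le> \<eta>" using \<eta>'(2) by simp
  qed
qed

lemma continuous_solution:
  assumes F: "continuous_on (({-e<..<e} \<times> V) \<times> Om) F" and Y0: "continuous_on V (Y 0)"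
  shows "continuous_on ({-e<..<e} \<times> V) (\<lambda>(t, q). Y t q)"
  unfolding continuous_on_iff
proof (intro ballI allI impI, clarify)
  fix t0 q0 and \<eta> :: real
  assume t0: "t0 \<in> {-e<..<e}" and q0: "q0 \<in> V" and \<eta>: "\<eta> > 0"
  define T where "T = (\<bar>t0\<bar> + e) / 2"
  have T: "0 < T" "T < e" "\<bar>t0\<bar> < T" using t0 e by (auto simp: T_def)
  obtain d where d: "d > 0" "\<forall>q\<in>ball q0 d. \<forall>t\<in>{-T..T}. norm (Y t q - Y t q0) \<le> \<eta> / 2"
    using uniformly_continuous_in_parameter[OF F Y0 q0 T(1,2) half_gt_zero[OF \<eta>]]
    by (elim exE conjE) (rule that; assumption)
  obtain d' where d': "d' > 0"
    "\<forall>t\<in>{-e<..<e}. dist t t0 < d' \<longrightarrow> dist (Y t q0) (Y t0 q0) < \<eta> / 2"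
    using continuous_in_time[OF q0, unfolded continuous_on_iff, rule_format, OF t0 half_gt_zero[OF \<eta>]]
    by (elim exE conjE) (rule that; simp)
  define r where "r = min (min d d') (T - \<bar>t0\<bar>)"
  have "dist (Y t q) (Y t0 q0) < \<eta>"
    if "t \<in> {-e<..<e}" "q \<in> V" "dist (t, q) (t0, q0) < r" for t q
  proof -
    have dt: "dist t t0 < r" and dq: "dist q q0 < r"
      using that(3) dist_fst_le[of "(t, q)" "(t0, q0)"] dist_snd_le[of "(t, q)" "(t0, q0)"] by auto
    have "t \<in> {-T..T}" using dt unfolding r_def dist_real_def by auto
    moreover have "q \<in> ball q0 d" using dq by (simp add: r_def dist_commute)
    ultimately have "dist (Y t q) (Y t q0) \<le> \<eta> / 2"
      using d(2) unfolding dist_norm by blast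
    moreover have "dist (Y t q0) (Y t0 q0) < \<eta> / 2"
      using d'(2) that(1) dt by (simp add: r_def)
    ultimately show ?thesis
      using dist_triangle[of "Y t q" "Y t0 q0" "Y t q0"] by linarith
  qed
  moreover have "r > 0" using d(1) d'(1) T(3) by (simp add: r_def)
  ultimately show "\<exists>r>0. \<forall>z\<in>{-e<..<e} \<times> V. dist z (t0, q0) < r \<longrightarrow>
      dist (case z of (t, q) \<Rightarrow> Y t q) (Y t0 q0) < \<eta>"
    by auto
qed

text \<open>
  The candidate \<open>Z\<close> for the derivative is the solution of the linearized equation, obtained for each
  basis direction and extended linearly. The error \<open>Y t q - Y t q0 - Z t (q - q0)\<close> satisfies the same
  linear equation up to the first-order remainder of \<open>F\<close>, and that is uniformly small along the
  compact curve. The solution is sought on a closed interval \<open>{-T..T}\<close>, where compactness is available.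
\<close>

theorem variational_equation:
  assumes F: "td (Suc 0) (({-e<..<e} \<times> V) \<times> Om) F" and Y0: "td (Suc 0) V (Y 0)"
    and q0: "q0 \<in> V" and T: "0 < T" "T < e"
  shows "\<exists>Z. \<forall>t\<in>{-T..T}. (Y t has_derivative Z t) (at q0) \<and>
    (\<forall>h. ((\<lambda>t. Z t h) has_vector_derivative
      frechet_derivative F (at ((t, q0), Y t q0)) ((0, h), Z t h)) (at t within {-T..T}))"
proof -
  define c where "c s = ((s, q0), Y s q0)" for s
  define D where "D s = frechet_derivative F (at (c s))" for s
  define D0 where "D0 = frechet_derivative (Y 0) (at q0)"
  let ?S = "({-e<..<e} \<times> V) \<times> Om"
  have oS: "open ?S" by (intro open_Times open_V open_Om open_greaterThanLessThan)
  have J: "t \<in> {-e<..<e}" if "t \<in> {-T..T}" for t using that T by auto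
  have cS: "c s \<in> ?S" if "s \<in> {-T..T}" for s
    unfolding c_def using J[OF that] q0 Y_in by auto
  have cont_c: "continuous_on {-T..T} c"
    unfolding c_def using J by (intro continuous_intros continuous_on_subset[OF continuous_in_time[OF q0]]) auto
  have D0: "(Y 0 has_derivative D0) (at q0)"
    unfolding D0_def by (rule td_SucE(1)[OF Y0 q0])
  have D: "(F has_derivative D s) (at (c s))" if "s \<in> {-T..T}" for s
    unfolding D_def by (rule td_SucE(1)[OF F cS[OF that]])
  have linD: "linear (D s)" if "s \<in> {-T..T}" for s
    using D[OF that] has_derivative_linear by blast
  have linD0: "linear D0" using D0 has_derivative_linear by blast
  have DL: "norm (D s (0, w)) \<le> L * norm w" if "s \<in> {-T..T}" for s w
    unfolding D_def c_def
    using norm_frechet_derivative_le_Lipschitz[OF F _ open_Om, of L "(s, q0)" "Y s q0" w]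
      Lipschitz Y_in[OF J[OF that] q0] J[OF that] q0 open_Times[OF open_greaterThanLessThan open_V]
    by force
  define A where "A s = Blinfun (frechet_derivative F (at (c s)))" for s
  have A: "blinfun_apply (A s) = D s" if "s \<in> {-T..T}" for s
    unfolding A_def D_def by (rule td_continuous_frechet_blinfun(2)[OF F cS[OF that]])
  have cont_A: "continuous_on {-T..T} A"
    unfolding A_def
    by (rule continuous_on_compose2[OF td_continuous_frechet_blinfun(1)[OF F] cont_c])
      (use cS in blast)
  have "\<exists>\<zeta>. \<zeta> 0 = D0 h \<and> (\<forall>t\<in>{-T..T}. (\<zeta> has_vector_derivative D t ((0, h), \<zeta> t)) (at t within {-T..T}))" for h
  proof -
    have "continuous_on ({-T..T} \<times> UNIV) (\<lambda>z. A (fst z))"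
      by (rule continuous_on_compose2[OF cont_A]) (auto intro!: continuous_intros)
    then have cont: "continuous_on ({-T..T} \<times> UNIV) (\<lambda>(t, y). blinfun_apply (A t) ((0, h), y))"
      unfolding split_beta by (intro continuous_intros)
    have "norm (blinfun_apply (A t) ((0, h), y) - blinfun_apply (A t) ((0, h), z)) \<le> L * norm (y - z)"
      if t: "t \<in> {-T..T}" for t y z
    proof -
      have "D t ((0, h), y) - D t ((0, h), z) = D t (0, y - z)"
        using linear_diff[OF linD[OF t], of "((0, h), y)" "((0, h), z)"] by (simp add: zero_prod_def)
      then show ?thesis using A[OF t] DL[OF t] by simp
    qed
    from picard_short_time[OF T(1) L _ cont this, of "D0 h"] short_time[OF T] show ?thesis
      using A by auto
  qed
  then have "\<exists>\<zeta>. \<forall>h. \<zeta> h 0 = D0 h \<and>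
      (\<forall>t\<in>{-T..T}. (\<zeta> h has_vector_derivative D t ((0, h), \<zeta> h t)) (at t within {-T..T}))"
    by (intro choice allI)
  then obtain \<zeta> where \<zeta>: "\<forall>h. \<zeta> h 0 = D0 h \<and>
      (\<forall>t\<in>{-T..T}. (\<zeta> h has_vector_derivative D t ((0, h), \<zeta> h t)) (at t within {-T..T}))" ..
  note \<zeta>0 = \<zeta>[THEN spec, THEN conjunct1] and \<zeta> = \<zeta>[THEN spec, THEN conjunct2, THEN bspec]
  define Z where "Z t h = (\<Sum>b\<in>Basis. (h \<bullet> b) *\<^sub>R \<zeta> b t)" for t h
  have Z0: "Z 0 h = D0 h" for h
    unfolding Z_def \<zeta>0 by (rule linear_eq_sum_Basis[OF linD0, symmetric])
  have Z: "((\<lambda>t. Z t h) has_vector_derivative D t ((0, h), Z t h)) (at t within {-T..T})"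
    if "t \<in> {-T..T}" for t h
  proof -
    have "((0, h), Z t h) = (\<Sum>b\<in>Basis. (h \<bullet> b) *\<^sub>R ((0 :: real, b), \<zeta> b t))"
      by (simp add: Z_def scaleR_Pair sum_prod euclidean_representation)
    then have "D t ((0, h), Z t h) = (\<Sum>b\<in>Basis. (h \<bullet> b) *\<^sub>R D t ((0, b), \<zeta> b t))"
      by (simp only: linear_sum[OF linD[OF that]] linear_cmul[OF linD[OF that]])
    then show ?thesis unfolding Z_def
      by (auto intro!: has_vector_derivative_sum bounded_linear.has_vector_derivative[OF bounded_linear_scaleR_right] \<zeta> that)
  qed
  have "\<exists>C. \<forall>t\<in>{-T..T}. norm (\<zeta> b t) \<le> C" for b
  proof -
    have "continuous_on {-T..T} (\<zeta> b)" using \<zeta> by (rule continuous_on_vector_derivative)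
    then have "bounded (\<zeta> b ` {-T..T})"
      by (intro compact_imp_bounded compact_continuous_image compact_Icc)
    then show ?thesis unfolding bounded_iff by auto
  qed
  then obtain Cb where Cb: "\<And>b t. t \<in> {-T..T} \<Longrightarrow> norm (\<zeta> b t) \<le> Cb b" by metis
  define C where "C = (\<Sum>b\<in>Basis. Cb b)"
  have ZC: "norm (Z t h) \<le> C * norm h" if "t \<in> {-T..T}" for t h
  proof -
    have "norm (Z t h) \<le> (\<Sum>b\<in>Basis. norm h * Cb b)"
      unfolding Z_def using Cb[OF that]
      by (intro sum_norm_le) (auto intro!: mult_mono simp: Basis_le_norm)
    then show ?thesis by (simp add: C_def sum_distrib_left mult.commute)
  qed
  have C0: "C \<ge> 0"
    unfolding C_def using Cb[of 0] T by (intro sum_nonneg order_trans[OF norm_ge_zero]) auto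
  show ?thesis
  proof (intro exI[of _ Z] ballI conjI allI)
    show "((\<lambda>t. Z t h) has_vector_derivative
        frechet_derivative F (at ((t, q0), Y t q0)) ((0, h), Z t h)) (at t within {-T..T})"
      if "t \<in> {-T..T}" for t h
      using Z[OF that] unfolding D_def c_def .
    fix t assume t: "t \<in> {-T..T}"
    have linZ: "bounded_linear (Z t)"
      unfolding Z_def by (intro bounded_linear_sum bounded_linear_scaleR_left[THEN bounded_linear_compose]
          bounded_linear_inner_left)
    show "(Y t has_derivative Z t) (at q0)"
      unfolding has_derivative_at_alt
    proof (intro conjI allI impI linZ)
      fix \<eta> :: real assume \<eta>: "\<eta> > 0"
      define M where "M = 1 + T * (1 + C)"
      have M: "M > 0" using T(1) C0 by (simp add: M_def add_pos_nonneg)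
      \<comment> \<open>The second bound keeps the constant \<open>L + \<eta>'\<close> of the error equation within \<open>1 / (2 * T)\<close>.\<close>
      define \<eta>' where "\<eta>' = min (\<eta> / (2 * M)) (1 / (4 * T))"
      have \<eta>': "\<eta>' > 0" "T * \<eta>' \<le> 1/4" "2 * \<eta>' * M \<le> \<eta>"
      proof -
        show "\<eta>' > 0" using M T(1) \<eta> by (simp add: \<eta>'_def)
        have "\<eta>' \<le> 1 / (4 * T)" "\<eta>' \<le> \<eta> / (2 * M)" by (simp_all add: \<eta>'_def)
        then show "T * \<eta>' \<le> 1/4" "2 * \<eta>' * M \<le> \<eta>"
          using T(1) M by (simp_all add: field_simps)
      qed
      obtain \<delta> where \<delta>: "\<delta> > 0"
        "\<And>x k. x \<in> c ` {-T..T} \<Longrightarrow> norm k < \<delta> \<Longrightarrow>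
          norm (F (x + k) - F x - frechet_derivative F (at x) k) \<le> \<eta>' * norm k"
        using uniform_differentiability[OF F oS compact_continuous_image[OF cont_c compact_Icc] _ \<eta>'(1)] cS
        by (metis image_subsetI)
      obtain d0 where d0: "d0 > 0"
        "\<And>q. norm (q - q0) < d0 \<Longrightarrow> norm (Y 0 q - Y 0 q0 - D0 (q - q0)) \<le> \<eta>' * norm (q - q0)"
        using D0 \<eta>'(1) unfolding has_derivative_at_alt by blast
      have "\<delta> / 3 > 0" using \<delta>(1) by simp
      from uniformly_continuous_in_parameter[OF td_imp_continuous_on[OF F] td_imp_continuous_on[OF Y0] q0 T this]
      obtain d1 where d1: "d1 > 0" "ball q0 d1 \<subseteq> V"
        "\<forall>q\<in>ball q0 d1. \<forall>s\<in>{-T..T}. norm (Y s q - Y s q0) \<le> \<delta> / 3"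
        by (elim exE conjE) (rule that; assumption)
      define d where "d = min (min d0 d1) (\<delta> / 3)"
      have "norm (Y t q - Y t q0 - Z t (q - q0)) \<le> \<eta> * norm (q - q0)" if q: "norm (q - q0) < d" for q
      proof -
        define h where "h = q - q0"
        define u where "u s = Y s q - Y s q0" for s
        define g where "g s = u s - Z s h" for s
        have qb: "q \<in> ball q0 d1" using q by (simp add: d_def dist_norm norm_minus_commute)
        then have qV: "q \<in> V" using d1(2) by blast
        have "norm (g t) \<le> 2 * (norm (g 0) + T * (\<eta>' * (1 + C) * norm h))"
        proof (rule norm_le_short_time[where L="L + \<eta>'", OF _ _ _ _ _ t])
          show "T * (L + \<eta>') \<le> 1/2" using short_time[OF T] \<eta>'(2) by (simp add: distrib_left)
          fix s assume s: "s \<in> {-T..T}"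
          define k where "k = ((0::real, h), u s)"
          show "(g has_vector_derivative F ((s, q), Y s q) - F ((s, q0), Y s q0) - D s ((0, h), Z s h))
              (at s within {-T..T})"
            unfolding g_def u_def by (intro has_vector_derivative_diff ode_within Z s T qV q0)
          have ck: "c s + k = ((s, q), Y s q)" by (simp add: c_def k_def h_def u_def)
          have nk: "norm k \<le> norm h + norm (u s)"
            using norm_Pair_le[of "(0::real, h)" "u s"] by (simp add: k_def norm_Pair)
          moreover have "norm h < \<delta> / 3" using q by (simp add: h_def d_def)
          moreover have "norm (u s) \<le> \<delta> / 3" using d1(3) qb s by (simp add: u_def)
          ultimately have "norm k < \<delta>" using \<delta>(1) by linarith
          then have R: "norm (F (c s + k) - F (c s) - D s k) \<le> \<eta>' * norm k"
            unfolding D_def using \<delta>(2)[of "c s" k] s by blast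
          have "D s k - D s ((0, h), Z s h) = D s (0, g s)"
            using linear_diff[OF linD[OF s], of k "((0, h), Z s h)"] by (simp add: k_def g_def zero_prod_def)
          then have "norm (D s k - D s ((0, h), Z s h)) \<le> L * norm (g s)"
            using DL[OF s] by simp
          then have "norm (F (c s + k) - F (c s) - D s ((0, h), Z s h)) \<le> \<eta>' * norm k + L * norm (g s)"
            using norm_diff_triangle_le[OF R] by blast
          also have "\<eta>' * norm k \<le> \<eta>' * (norm h + (norm (g s) + C * norm h))"
          proof -
            have "norm (u s) \<le> norm (g s) + C * norm h"
              using norm_triangle_ineq[of "g s" "Z s h"] ZC[OF s, of h] by (simp add: g_def)
            then show ?thesis using nk \<eta>'(1) by (intro mult_left_mono) auto
          qed
          finally show "norm (F ((s, q), Y s q) - F ((s, q0), Y s q0) - D s ((0, h), Z s h))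
              \<le> (L + \<eta>') * norm (g s) + \<eta>' * (1 + C) * norm h"
            unfolding ck by (simp add: c_def algebra_simps)
        qed (use T L \<eta>'(1) in auto)
        also have "norm (g 0) \<le> \<eta>' * norm h"
          using d0(2)[of q] q by (simp add: g_def u_def Z0 h_def d_def)
        finally have "norm (g t) \<le> (2 * \<eta>' * M) * norm h"
          by (simp add: M_def algebra_simps)
        also have "\<dots> \<le> \<eta> * norm h" using \<eta>'(3) by (intro mult_right_mono) auto
        finally show ?thesis by (simp add: g_def u_def h_def)
      qed
      moreover have "d > 0" using d0(1) d1(1) \<delta>(1) by (simp add: d_def)
      ultimately show "\<exists>d>0. \<forall>q. norm (q - q0) < d \<longrightarrow>
          norm (Y t q - Y t q0 - Z t (q - q0)) \<le> \<eta> * norm (q - q0)"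
        by blast
    qed
  qed
qed

end

text \<open>
  In the step, \<open>DY (\<tau>, v) = \<tau> F + Z v\<close>, where \<open>Z v\<close> is the derivative in the parameter direction \<open>v\<close>.
  The variational equation puts \<open>Z v\<close> in the same class with a right-hand side built from \<open>DF\<close>
  and \<open>Y\<close>, both of one order less, so the induction hypothesis applies to it.
\<close>

theorem times_differentiable_solution:
  assumes "short_time_ode e L V Om F Y"
    and "td n (({-e<..<e} \<times> V) \<times> Om) F" and "td n V (Y 0)"
  shows "td n ({-e<..<e} \<times> V) (\<lambda>(t, q). Y t q)"
  using assms
proof (induction n arbitrary: Om F Y)
  case 0
  then show ?case using short_time_ode.continuous_solution by auto
next
  case (Suc n)
  interpret short_time_ode e L V Om F Y by fact
  note F = Suc.prems(2) and Y0 = Suc.prems(3)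
  let ?J = "{-e<..<e}"
  let ?S = "?J \<times> V"
  let ?y = "\<lambda>(t, q). Y t q"
  have oS: "open ?S" and oSO: "open (?S \<times> Om)" and oSU: "open (?S \<times> (UNIV :: 'b set))"
    by (intro open_Times open_V open_Om open_greaterThanLessThan open_UNIV)+
  have F1: "td (Suc 0) (?S \<times> Om) F" and Y1: "td (Suc 0) V (Y 0)"
    using td_Suc_imp_td_1[OF F] td_Suc_imp_td_1[OF Y0] by auto
  have y: "td n ?S ?y"
    by (rule Suc.IH[OF Suc.prems(1) td_SucD[OF F] td_SucD[OF Y0]])
  have Fy: "td n ?S (\<lambda>r. F (r, ?y r))"
    by (rule td_compose[OF oS _ td_SucD[OF F] td_Pair[OF oS td_id[OF oS] y]]) (auto intro: Y_in)
  define Z where "Z v t q = frechet_derivative (Y t) (at q) v" for v t q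
  have dY: "(Y t has_derivative (\<lambda>v. Z v t q)) (at q)"
    and Z': "((\<lambda>t. Z v t q) has_vector_derivative
        frechet_derivative F (at ((t, q), Y t q)) ((0, v), Z v t q)) (at t)"
    if t: "t \<in> ?J" and q: "q \<in> V" for t q v
  proof -
    define T where "T = (\<bar>t\<bar> + e) / 2"
    have T: "0 < T" "T < e" "\<bar>t\<bar> < T" using t e by (auto simp: T_def)
    from variational_equation[OF F1 Y1 q T(1,2)] obtain \<zeta> where
      \<zeta>: "\<forall>t\<in>{-T..T}. (Y t has_derivative \<zeta> t) (at q) \<and>
        (\<forall>h. ((\<lambda>t. \<zeta> t h) has_vector_derivative
          frechet_derivative F (at ((t, q), Y t q)) ((0, h), \<zeta> t h)) (at t within {-T..T}))" ..
    \<comment> \<open>The solution \<open>\<zeta>\<close> depends on \<open>T\<close>, but as a derivative it is unique; so the equation holds on all of \<open>?J\<close>.\<close>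
    have eq: "\<zeta> s h = Z h s q" if "s \<in> {-T..T}" for s h
      unfolding Z_def using frechet_derivative_at[OF \<zeta>[THEN bspec, OF that, THEN conjunct1]] by simp
    have tT: "t \<in> {-T..T}" "t \<in> interior {-T..T}" using T(3) by (auto simp: interior_atLeastAtMost_real)
    have "\<zeta> t = (\<lambda>v. Z v t q)" using eq[OF tT(1)] by auto
    then show "(Y t has_derivative (\<lambda>v. Z v t q)) (at q)" using \<zeta> tT(1) by metis
    have "((\<lambda>t. \<zeta> t v) has_vector_derivative
          frechet_derivative F (at ((t, q), Y t q)) ((0, v), \<zeta> t v)) (at t within {-T..T})"
      using \<zeta> tT(1) by blast
    then have "((\<lambda>t. Z v t q) has_vector_derivative
          frechet_derivative F (at ((t, q), Y t q)) ((0, v), Z v t q)) (at t within {-T..T})"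
      unfolding eq[OF tT(1)] by (rule has_vector_derivative_transform[OF tT(1), rotated]) (simp add: eq)
    then show "((\<lambda>t. Z v t q) has_vector_derivative
        frechet_derivative F (at ((t, q), Y t q)) ((0, v), Z v t q)) (at t)"
      using at_within_interior[OF tT(2)] by simp
  qed
  have Z: "td n ?S (\<lambda>(t, q). Z v t q)" for v
  proof (rule Suc.IH)
    define G where "G \<rho> = frechet_derivative F (at (fst \<rho>, ?y (fst \<rho>))) ((0, v), snd \<rho>)" for \<rho> :: "(real \<times> 'a) \<times> 'b"
    let ?D = "\<lambda>\<rho>. frechet_derivative F (at (fst \<rho>, ?y (fst \<rho>)))"
    have lin: "linear (?D \<rho>)" if "\<rho> \<in> ?S \<times> (UNIV :: 'b set)" for \<rho>
      using td_SucE(1)[OF F, of "(fst \<rho>, ?y (fst \<rho>))"] that Y_in has_derivative_linear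
      by (auto simp: mem_Times_iff split_beta)
    show "short_time_ode e L V UNIV G (Z v)"
    proof
      fix t q and y z :: 'b assume tq: "t \<in> ?J" "q \<in> V"
      have "G ((t, q), y) - G ((t, q), z) = frechet_derivative F (at ((t, q), Y t q)) (0, y - z)"
        using linear_diff[OF lin, of "((t, q), y)" "((0, v), y)" "((0, v), z)"] tq
        by (simp add: G_def zero_prod_def)
      also have "norm \<dots> \<le> L * norm (y - z)"
        using norm_frechet_derivative_le_Lipschitz[OF F1 oS open_Om, of L "(t, q)" "Y t q" "y - z"]
          Lipschitz Y_in[OF tq] tq by force
      finally show "norm (G ((t, q), y) - G ((t, q), z)) \<le> L * norm (y - z)" .
    qed (use Z' eL in \<open>auto simp: G_def e L open_V\<close>)
    have \<psi>: "td n (?S \<times> (UNIV :: 'b set)) (\<lambda>\<rho>. ?y (fst \<rho>))"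
      by (rule td_compose[OF oSU _ y td_linear[OF oSU bounded_linear_fst]]) auto
    have D: "td n (?S \<times> (UNIV :: 'b set)) (\<lambda>\<rho>. ?D \<rho> w)" for w
      by (rule td_compose[OF oSU _ td_SucE(2)[OF F] td_Pair[OF oSU td_linear[OF oSU bounded_linear_fst] \<psi>]])
        (use Y_in in auto)
    have "G \<rho> = ?D \<rho> ((0, v), 0) + (\<Sum>b\<in>Basis. (snd \<rho> \<bullet> b) *\<^sub>R ?D \<rho> (0, b))"
      if "\<rho> \<in> ?S \<times> (UNIV :: 'b set)" for \<rho>
    proof -
      have "((0, v), snd \<rho>) = ((0, v), 0) + (\<Sum>b\<in>Basis. (snd \<rho> \<bullet> b) *\<^sub>R (0 :: real \<times> 'a, b))"
        by (simp add: sum_prod euclidean_representation)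
      then show ?thesis unfolding G_def
        by (simp only: linear_add[OF lin[OF that]] linear_sum[OF lin[OF that]] linear_cmul[OF lin[OF that]])
    qed
    moreover have "td n (?S \<times> (UNIV :: 'b set))
        (\<lambda>\<rho>. ?D \<rho> ((0, v), 0) + (\<Sum>b\<in>Basis. (snd \<rho> \<bullet> b) *\<^sub>R ?D \<rho> (0, b)))"
      by (intro td_add[OF oSU] D td_sum[OF oSU] td_bilinear[OF oSU bounded_bilinear_scaleR]
          td_bounded_linear[OF oSU bounded_linear_inner_left] td_linear[OF oSU bounded_linear_snd])
    ultimately show "td n (?S \<times> UNIV) G"
      by (subst td_cong[OF oSU]) auto
    show "td n V (Z v 0)"
      unfolding Z_def by (rule td_SucE(2)[OF Y0])
  qed
  show ?case
  proof (rule td_SucI[OF oS])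
    fix r assume "r \<in> ?S"
    then obtain t q where r: "r = (t, q)" and tq: "t \<in> ?J" "q \<in> V" by auto
    have cF: "continuous_on ?S (\<lambda>r. F (r, ?y r))" using Fy td_imp_continuous_on by blast
    have sw: "continuous_on (V \<times> ?J) (\<lambda>z. F ((snd z, fst z), Y (snd z) (fst z)))"
      using continuous_on_compose2[OF cF, of "V \<times> ?J" "\<lambda>z. (snd z, fst z)"]
      by (simp add: continuous_on_Pair continuous_on_fst continuous_on_snd image_subset_iff mem_Times_iff)
    have "((\<lambda>(q, t). Y t q) has_derivative
        (\<lambda>(v, \<tau>). Z v t q + blinfun_scaleR_left (F ((t, q), Y t q)) \<tau>)) (at (q, t) within V \<times> ?J)"
    proof (rule has_derivative_partialsI[where fy="\<lambda>q t. blinfun_scaleR_left (F ((t, q), Y t q))"])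
      show "((\<lambda>q. Y t q) has_derivative (\<lambda>v. Z v t q)) (at q within V)"
        using dY[OF tq] by (rule has_derivative_at_withinI)
      show "((\<lambda>t. Y t q) has_derivative blinfun_apply (blinfun_scaleR_left (F ((t, q), Y t q)))) (at t within ?J)"
        if "q \<in> V" "t \<in> ?J" for q t
        using ode[OF that(2,1)] unfolding has_vector_derivative_def
        by (auto intro: has_derivative_at_withinI)
      have "continuous_on (V \<times> ?J) (\<lambda>z. blinfun_scaleR_left (F ((snd z, fst z), Y (snd z) (fst z))))"
        using bounded_linear.continuous_on[OF bounded_linear_blinfun_scaleR_left sw] .
      then show "continuous (at (q, t) within V \<times> ?J) (\<lambda>(q, t). blinfun_scaleR_left (F ((t, q), Y t q)))"
        using tq unfolding split_beta continuous_on_eq_continuous_within by blast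
    qed (use tq in auto)
    then have "((\<lambda>(q, t). Y t q) has_derivative
        (\<lambda>(v, \<tau>). Z v t q + \<tau> *\<^sub>R F ((t, q), Y t q))) (at (snd r, fst r))"
      using tq at_within_open[OF _ open_Times[OF open_V open_greaterThanLessThan[of "-e" e]], of "(q, t)"]
      by (simp add: r)
    from has_derivative_compose[OF has_derivative_Pair[OF has_derivative_snd[OF has_derivative_ident] has_derivative_fst[OF has_derivative_ident]] this]
    show "(?y has_derivative (\<lambda>w. Z (snd w) (fst r) (snd r) + fst w *\<^sub>R F (r, ?y r))) (at r)"
      by (simp add: case_prod_unfold r)
  next
    fix w :: "real \<times> 'a"
    show "td n ?S (\<lambda>r. Z (snd w) (fst r) (snd r) + fst w *\<^sub>R F (r, ?y r))"
      using Z[of "snd w"] by (intro td_add[OF oS] td_bounded_linear[OF oS bounded_linear_scaleR_right] Fy) (simp add: case_prod_unfold)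
  qed
qed

text \<open>
  Composing \<open>W\<close> with the projection to the closed ball makes it globally Lipschitz and bounded, so that
  Picard's theorem applies; for a short time the solutions starting in
  the half ball do not reach the sphere, and so solve the original equation.
\<close>

theorem local_smooth_flow:
  fixes W :: "'a::euclidean_space \<Rightarrow> 'a"
  assumes W: "smooth_on U W" and U: "open U" "cball p r \<subseteq> U" and r: "r > 0"
  shows "\<exists>e>0. \<exists>\<phi>. smooth_on ({-e<..<e} \<times> ball p (r / 2)) (\<lambda>(t, q). \<phi> t q) \<and>
    (\<forall>q\<in>ball p (r / 2). \<phi> 0 q = q \<and>
      (\<forall>t\<in>{-e<..<e}. \<phi> t q \<in> ball p r \<and> ((\<lambda>t. \<phi> t q) has_vector_derivative W (\<phi> t q)) (at t)))"
proof -
  have Wn: "td n U W" for n using W by (simp add: smooth_on_def)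
  obtain L where L: "L \<ge> 0"
    "\<And>x y. x \<in> cball p r \<Longrightarrow> y \<in> cball p r \<Longrightarrow> norm (W x - W y) \<le> L * norm (x - y)"
    using td_Lipschitz_cball[OF Wn U(2)] by blast
  have "compact (W ` cball p r)"
    using continuous_on_subset[OF td_imp_continuous_on[OF Wn] U(2)] by (intro compact_continuous_image) auto
  then obtain M where M: "M > 0" "\<And>x. x \<in> cball p r \<Longrightarrow> norm (W x) \<le> M"
    using compact_imp_bounded bounded_pos by (smt (verit) imageI)
  \<comment> \<open>Short enough for the contraction, and for speed at most \<open>M\<close> to cover less than \<open>r / 2\<close>.\<close>
  define T where "T = min (1 / (2 * (L + 1))) (r / (4 * (M + 1)))"
  have T: "T > 0" "T * L \<le> 1/2" "T * M < r / 4"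
  proof -
    show "T > 0" using L M r by (simp add: T_def)
    have "T \<le> 1 / (2 * (L + 1))" "T \<le> r / (4 * (M + 1))" by (simp_all add: T_def)
    then have "T * (2 * (L + 1)) \<le> 1" "T * (4 * (M + 1)) \<le> r"
      using L M by (simp_all add: pos_le_divide_eq)
    then show "T * L \<le> 1/2" "T * M < r / 4" using \<open>T > 0\<close> by (simp_all add: algebra_simps)
  qed
  define cp where "cp = closest_point (cball p r)"
  have cp: "cp y \<in> cball p r" "norm (cp y - cp z) \<le> norm (y - z)" for y z
    unfolding cp_def using r closest_point_in_set[of "cball p r" y]
      closest_point_lipschitz[of "cball p r" y z] by (auto simp: dist_norm)
  have cp_id: "cp y = y" if "y \<in> cball p r" for y
    unfolding cp_def using closest_point_self[OF that] .
  have lip: "norm (W (cp y) - W (cp z)) \<le> L * norm (y - z)" for y z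
    using L(2)[OF cp(1) cp(1)] mult_left_mono[OF cp(2) L(1)] order_trans by blast
  have "continuous_on UNIV cp"
    unfolding cp_def using r by (intro continuous_on_closest_point) auto
  then have "continuous_on UNIV (\<lambda>y. W (cp y))"
    using continuous_on_compose2[OF td_imp_continuous_on[OF Wn]] cp(1) U(2) by blast
  then have cont: "continuous_on ({-T..T} \<times> UNIV) (\<lambda>(t :: real, y). W (cp y))"
    unfolding split_beta by (rule continuous_on_compose2) (auto intro!: continuous_intros)
  have "\<exists>\<phi>. \<forall>q. \<phi> q 0 = q \<and> (\<forall>t\<in>{-T..T}. (\<phi> q has_vector_derivative W (cp (\<phi> q t))) (at t within {-T..T}))"
    by (intro choice allI picard_short_time[OF T(1) L(1) T(2) cont] lip)
  then obtain \<phi> where \<phi>: "\<forall>q. \<phi> q 0 = q \<and>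
    (\<forall>t\<in>{-T..T}. (\<phi> q has_vector_derivative W (cp (\<phi> q t))) (at t within {-T..T}))" ..
  note \<phi>0 = \<phi>[THEN spec, THEN conjunct1] and \<phi>' = \<phi>[THEN spec, THEN conjunct2, THEN bspec]
  have stay: "\<phi> q t \<in> ball p r" if q: "q \<in> ball p (r / 2)" and t: "t \<in> {-T..T}" for q t
  proof -
    have "norm (\<phi> q t - q) \<le> 2 * (norm (\<phi> q 0 - q) + T * M)"
    proof (rule norm_le_short_time[where L=0, OF _ _ _ _ _ t])
      show "((\<lambda>t. \<phi> q t - q) has_vector_derivative W (cp (\<phi> q s)) - 0) (at s within {-T..T})"
        if "s \<in> {-T..T}" for s
        using \<phi>'[OF that] by (intro has_vector_derivative_diff has_vector_derivative_const)
    qed (use T M(2)[OF cp(1)] in auto)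
    then have "dist (\<phi> q t) q < r / 2" using T(3) by (simp add: \<phi>0 dist_norm)
    then show ?thesis using q dist_triangle[of p "\<phi> q t" q] by (simp add: dist_commute)
  qed
  \<comment> \<open>Halving \<open>T\<close> turns the bound \<open>T * L \<le> 1/2\<close> into the \<open>1/4\<close> required of \<open>e\<close>.\<close>
  define e where "e = T / 2"
  have e: "e > 0" "e < T" "e * L \<le> 1/4" using T by (auto simp: e_def algebra_simps)
  have ode: "(\<phi> q has_vector_derivative W (\<phi> q t)) (at t)"
    if q: "q \<in> ball p (r / 2)" and t: "t \<in> {-e<..<e}" for q t
  proof -
    have tT: "t \<in> {-T..T}" "t \<in> interior {-T..T}"
      using t e by (auto simp: interior_atLeastAtMost_real)
    have "cp (\<phi> q t) = \<phi> q t" using cp_id stay[OF q tT(1)] by auto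
    then show ?thesis using \<phi>'[OF tT(1), of q] at_within_interior[OF tT(2)] by simp
  qed
  have J: "t \<in> {-T..T}" if "t \<in> {-e<..<e}" for t using that e by auto
  have short: "short_time_ode e L (ball p (r / 2)) (ball p r) (\<lambda>z. W (snd z)) (\<lambda>t q. \<phi> q t)"
  proof
    fix y z assume "y \<in> ball p r" "z \<in> ball p r"
    then show "norm (W (snd ((t, q), y)) - W (snd ((t, q), z))) \<le> L * norm (y - z)"
      for t :: real and q :: 'a using L(2)[of y z] by simp
  qed (use e L stay ode J in auto)
  have "td n ({-e<..<e} \<times> ball p (r / 2)) (\<lambda>(t, q). \<phi> q t)" for n
  proof (rule times_differentiable_solution[OF short])
    have o: "open (({-e<..<e} \<times> ball p (r / 2)) \<times> ball p r)"
      by (intro open_Times open_ball open_greaterThanLessThan)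
    show "td n (({-e<..<e} \<times> ball p (r / 2)) \<times> ball p r) (\<lambda>z. W (snd z))"
      by (rule td_compose[OF o _ Wn td_linear[OF o bounded_linear_snd]]) (use U(2) in auto)
    show "td n (ball p (r / 2)) (\<lambda>q. \<phi> q 0)"
      unfolding \<phi>0 by (rule td_id) simp
  qed
  then show ?thesis
    using e(1) \<phi>0 stay ode J
    by (intro exI[of _ e] conjI exI[of _ "\<lambda>t q. \<phi> q t"]) (auto simp: smooth_on_def)
qed

section \<open>Slow flows stay transversal\<close>

definition cross2 :: "real^2 \<Rightarrow> real^2 \<Rightarrow> real" where
  "cross2 a b = a$1 * b$2 - a$2 * b$1"

lemma cross2_nonzero_imp_lin_indep_pair:
  assumes "cross2 a b \<noteq> 0"
  shows "lin_indep_pair a b"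
proof -
  have "a \<noteq> b" using assms by (auto simp: cross2_def)
  moreover have "a \<notin> span {b}" "b \<noteq> 0" using assms by (auto simp: cross2_def span_singleton)
  ultimately show ?thesis by (simp add: lin_indep_pair_def independent_insert)
qed

lemma lin_indep_pair_combination_zero:
  fixes a b :: "'a::real_vector"
  assumes "lin_indep_pair a b" "s *\<^sub>R a + t *\<^sub>R b = 0"
  shows "s = 0 \<and> t = 0"
proof -
  have ab: "a \<notin> span {b}" "b \<noteq> 0"
    using assms(1) by (auto simp: lin_indep_pair_def independent_insert)
  have "s = 0"
  proof (rule ccontr)
    assume "s \<noteq> 0"
    have "s *\<^sub>R a = - t *\<^sub>R b" using assms(2) by (simp add: eq_neg_iff_add_eq_0)
    then have "a = (- t / s) *\<^sub>R b"
      using \<open>s \<noteq> 0\<close> by (metis divide_inverse_commute real_vector_affinity_eq scaleR_scaleR scaleR_one left_inverse)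
    then show False using ab(1) by (metis rangeI span_singleton)
  qed
  then show ?thesis using assms(2) ab(2) by simp
qed

lemma abs_cross2_le: "\<bar>cross2 a b\<bar> \<le> norm a * norm b"
proof (rule power2_le_imp_le)
  have "(cross2 a b)\<^sup>2 + (a \<bullet> b)\<^sup>2 = (norm a)\<^sup>2 * (norm b)\<^sup>2"
    unfolding power2_norm_eq_inner by (simp add: cross2_def inner_vec_def sum_2 power2_eq_square algebra_simps)
  then show "\<bar>cross2 a b\<bar>\<^sup>2 \<le> (norm a * norm b)\<^sup>2"
    by (simp add: power_mult_distrib) (metis le_add_same_cancel1 zero_le_power2)
qed simp

lemma cross2_diff: "cross2 a b - cross2 c d = cross2 (a - c) b + cross2 c (b - d)"
  by (simp add: cross2_def algebra_simps)

text \<open>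
  The speed is at most \<open>M \<bar>f\<bar>\<close>, and \<open>\<bar>f\<bar>\<close> grows at most linearly with the displacement. The point is
  that the bound is proportional to \<open>f\<close> at the starting point: orbits starting near the zero set of
  \<open>f\<close> hardly move.
\<close>

lemma slow_displacement:
  fixes \<phi> :: "real \<Rightarrow> 'a::real_normed_vector" and f :: "'a \<Rightarrow> real"
  assumes T: "0 \<le> T" "T * (M * L) \<le> 1/2" and L: "0 \<le> L" and M: "0 \<le> M"
    and ode: "\<And>t. t \<in> {-T..T} \<Longrightarrow> (\<phi> has_vector_derivative f (\<phi> t) *\<^sub>R v (\<phi> t)) (at t within {-T..T})"
    and S: "\<And>t. t \<in> {-T..T} \<Longrightarrow> \<phi> t \<in> S"
    and f: "\<And>x y. x \<in> S \<Longrightarrow> y \<in> S \<Longrightarrow> \<bar>f x - f y\<bar> \<le> L * norm (x - y)"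
    and v: "\<And>x. x \<in> S \<Longrightarrow> norm (v x) \<le> M"
    and t: "t \<in> {-T..T}"
  shows "norm (\<phi> t - \<phi> 0) \<le> 2 * T * M * \<bar>f (\<phi> 0)\<bar>"
proof -
  have "norm (\<phi> t - \<phi> 0) \<le> 2 * (norm (\<phi> 0 - \<phi> 0) + T * (M * \<bar>f (\<phi> 0)\<bar>))"
  proof (rule norm_le_short_time[where L="M * L", OF T _ _ _ t])
    fix s assume s: "s \<in> {-T..T}"
    show "((\<lambda>t. \<phi> t - \<phi> 0) has_vector_derivative f (\<phi> s) *\<^sub>R v (\<phi> s)) (at s within {-T..T})"
      using ode[OF s] by (auto intro!: derivative_eq_intros)
    have "\<bar>f (\<phi> s)\<bar> \<le> L * norm (\<phi> s - \<phi> 0) + \<bar>f (\<phi> 0)\<bar>"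
      using f[OF S[OF s] S[of 0]] T(1) by auto
    then have "\<bar>f (\<phi> s)\<bar> * norm (v (\<phi> s)) \<le> (L * norm (\<phi> s - \<phi> 0) + \<bar>f (\<phi> 0)\<bar>) * M"
      using v[OF S[OF s]] by (intro mult_mono) auto
    then show "norm (f (\<phi> s) *\<^sub>R v (\<phi> s)) \<le> M * L * norm (\<phi> s - \<phi> 0) + M * \<bar>f (\<phi> 0)\<bar>"
      by (simp add: algebra_simps)
  qed (use L M in auto)
  then show ?thesis by (simp add: algebra_simps)
qed

text \<open>
  The conclusion on \<open>v1\<close> and \<open>v2\<close> concerns two different points. Both lie within
  \<open>2 T M \<bar>f q\<bar>\<close> of \<open>q\<close>, so by Lipschitz continuity \<open>cross2 (v1 _) (v2 _)\<close> differs from its value at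
  \<open>q\<close> by at most \<open>T C \<bar>f q\<bar>\<close>, whereas that value is at least \<open>\<delta> \<bar>f q\<bar>\<close>.
  If \<open>f q = 0\<close>, the orbit is constant and \<open>f\<close> vanishes along it.
\<close>

theorem transversal_slow_flows:
  fixes f :: "real^2 \<Rightarrow> real" and v1 v2 :: "real^2 \<Rightarrow> real^2"
  assumes f: "smooth_on U f" and v1: "smooth_on U v1" and v2: "smooth_on U v2"
    and U: "open U" "cball p r \<subseteq> U" and r: "r > 0"
    and \<delta>: "\<delta> > 0" "\<And>q. q \<in> cball p r \<Longrightarrow> \<delta> * \<bar>f q\<bar> \<le> \<bar>cross2 (v1 q) (v2 q)\<bar>"
  shows "\<exists>e>0. \<exists>\<phi>1 \<phi>2.
    smooth_on ({-e<..<e} \<times> ball p (r / 2)) (\<lambda>(t, q). \<phi>1 t q) \<and>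
    smooth_on ({-e<..<e} \<times> ball p (r / 2)) (\<lambda>(t, q). \<phi>2 t q) \<and>
    (\<forall>q\<in>ball p (r / 2). \<phi>1 0 q = q \<and> \<phi>2 0 q = q \<and>
      (\<forall>t\<in>{-e<..<e}. \<phi>1 t q \<in> ball p r \<and> \<phi>2 t q \<in> ball p r \<and>
        ((\<lambda>t. \<phi>1 t q) has_vector_derivative f (\<phi>1 t q) *\<^sub>R v1 (\<phi>1 t q)) (at t) \<and>
        ((\<lambda>t. \<phi>2 t q) has_vector_derivative f (\<phi>2 t q) *\<^sub>R v2 (\<phi>2 t q)) (at t) \<and>
        (f (\<phi>1 t q) \<noteq> 0 \<longrightarrow> cross2 (v1 (\<phi>1 t q)) (v2 (\<phi>2 t q)) \<noteq> 0)))"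
proof -
  have fn: "td n U f" and vn: "td n U v1" "td n U v2" for n
    using f v1 v2 by (auto simp: smooth_on_def)
  have W: "smooth_on U (\<lambda>q. f q *\<^sub>R v1 q)" "smooth_on U (\<lambda>q. f q *\<^sub>R v2 q)"
    unfolding smooth_on_def by (auto intro!: td_bilinear[OF U(1) bounded_bilinear_scaleR] fn vn)
  obtain e1 \<phi>1 where e1: "e1 > 0"
    and \<phi>1: "smooth_on ({-e1<..<e1} \<times> ball p (r / 2)) (\<lambda>(t, q). \<phi>1 t q)"
    "\<And>q. q \<in> ball p (r / 2) \<Longrightarrow> \<phi>1 0 q = q"
    "\<And>q t. q \<in> ball p (r / 2) \<Longrightarrow> t \<in> {-e1<..<e1} \<Longrightarrow> \<phi>1 t q \<in> ball p r"
    "\<And>q t. q \<in> ball p (r / 2) \<Longrightarrow> t \<in> {-e1<..<e1} \<Longrightarrow>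
      ((\<lambda>t. \<phi>1 t q) has_vector_derivative f (\<phi>1 t q) *\<^sub>R v1 (\<phi>1 t q)) (at t)"
    using local_smooth_flow[OF W(1) U r] by blast
  obtain e2 \<phi>2 where e2: "e2 > 0"
    and \<phi>2: "smooth_on ({-e2<..<e2} \<times> ball p (r / 2)) (\<lambda>(t, q). \<phi>2 t q)"
    "\<And>q. q \<in> ball p (r / 2) \<Longrightarrow> \<phi>2 0 q = q"
    "\<And>q t. q \<in> ball p (r / 2) \<Longrightarrow> t \<in> {-e2<..<e2} \<Longrightarrow> \<phi>2 t q \<in> ball p r"
    "\<And>q t. q \<in> ball p (r / 2) \<Longrightarrow> t \<in> {-e2<..<e2} \<Longrightarrow>
      ((\<lambda>t. \<phi>2 t q) has_vector_derivative f (\<phi>2 t q) *\<^sub>R v2 (\<phi>2 t q)) (at t)"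
    using local_smooth_flow[OF W(2) U r] by blast
  obtain L0 where L0: "L0 \<ge> 0" "\<And>x y. x \<in> cball p r \<Longrightarrow> y \<in> cball p r \<Longrightarrow> norm (f x - f y) \<le> L0 * norm (x - y)"
    using td_Lipschitz_cball[OF fn U(2)] by blast
  obtain L1 where L1: "L1 \<ge> 0" "\<And>x y. x \<in> cball p r \<Longrightarrow> y \<in> cball p r \<Longrightarrow> norm (v1 x - v1 y) \<le> L1 * norm (x - y)"
    using td_Lipschitz_cball[OF vn(1) U(2)] by blast
  obtain L2 where L2: "L2 \<ge> 0" "\<And>x y. x \<in> cball p r \<Longrightarrow> y \<in> cball p r \<Longrightarrow> norm (v2 x - v2 y) \<le> L2 * norm (x - y)"
    using td_Lipschitz_cball[OF vn(2) U(2)] by blast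
  define M where "M = 1 + norm (v1 p) + norm (v2 p) + L1 * r + L2 * r"
  have M: "M > 0" using L1(1) L2(1) r by (simp add: M_def add_pos_nonneg)
  have v1M: "norm (v1 x) \<le> M" and v2M: "norm (v2 x) \<le> M" if "x \<in> cball p r" for x
  proof -
    have d: "norm (x - p) \<le> r" using that by (simp add: dist_norm norm_minus_commute)
    have p: "p \<in> cball p r" using r by simp
    have "norm (v1 x - v1 p) \<le> L1 * r"
      using L1(2)[OF that p] mult_left_mono[OF d L1(1)] by linarith
    moreover have "norm (v2 x - v2 p) \<le> L2 * r"
      using L2(2)[OF that p] mult_left_mono[OF d L2(1)] by linarith
    moreover have "L1 * r \<ge> 0" "L2 * r \<ge> 0" using L1(1) L2(1) r by auto
    ultimately show "norm (v1 x) \<le> M" "norm (v2 x) \<le> M"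
      using norm_triangle_sub[of "v1 x" "v1 p"] norm_triangle_sub[of "v2 x" "v2 p"]
        norm_ge_zero[of "v1 p"] norm_ge_zero[of "v2 p"] unfolding M_def by linarith+
  qed
  \<comment> \<open>\<open>T * C * \<bar>f q\<bar>\<close> bounds the change of the determinant between \<open>q\<close> and the two orbit points.\<close>
  define C where "C = (L1 + L2) * M * (2 * M)"
  have C: "C \<ge> 0" using L1(1) L2(1) M by (simp add: C_def)
  define T where "T = min (min (e1 / 2) (e2 / 2)) (min (1 / (2 * (M * L0 + 1))) (\<delta> / (C + 1)))"
  have T: "T > 0" "T < e1" "T < e2" "T * (M * L0) \<le> 1/2" "T * C < \<delta>"
  proof -
    have pos: "M * L0 \<ge> 0" using M L0 by simp
    then show T0: "T > 0" using e1 e2 \<delta>(1) C by (simp add: T_def add_nonneg_pos)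
    show "T < e1" "T < e2" using e1 e2 by (auto simp: T_def)
    have "T \<le> 1 / (2 * (M * L0 + 1))" "T \<le> \<delta> / (C + 1)" by (simp_all add: T_def)
    then have "T * (2 * (M * L0 + 1)) \<le> 1" "T * (C + 1) \<le> \<delta>"
      using pos C by (simp_all add: pos_le_divide_eq)
    then show "T * (M * L0) \<le> 1/2" "T * C < \<delta>" using T0 by (simp_all add: algebra_simps)
  qed
  have sb: "ball p r \<subseteq> cball p r" by auto
  have disp1: "norm (\<phi>1 t q - q) \<le> 2 * T * M * \<bar>f q\<bar>"
    if q: "q \<in> ball p (r / 2)" and t: "t \<in> {-T..T}" for t q
    using slow_displacement[where \<phi>="\<lambda>t. \<phi>1 t q" and S="cball p r" and v=v1 and f=f,
        OF less_imp_le[OF T(1)] T(4) L0(1) less_imp_le[OF M]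
          has_vector_derivative_at_within[OF \<phi>1(4)[OF q]] subsetD[OF sb \<phi>1(3)[OF q]] _ v1M t]
      T L0(2) \<phi>1(2)[OF q] by simp
  have disp2: "norm (\<phi>2 t q - q) \<le> 2 * T * M * \<bar>f q\<bar>"
    if q: "q \<in> ball p (r / 2)" and t: "t \<in> {-T..T}" for t q
    using slow_displacement[where \<phi>="\<lambda>t. \<phi>2 t q" and S="cball p r" and v=v2 and f=f,
        OF less_imp_le[OF T(1)] T(4) L0(1) less_imp_le[OF M]
          has_vector_derivative_at_within[OF \<phi>2(4)[OF q]] subsetD[OF sb \<phi>2(3)[OF q]] _ v2M t]
      T L0(2) \<phi>2(2)[OF q] by simp
  have transv: "cross2 (v1 (\<phi>1 t q)) (v2 (\<phi>2 t q)) \<noteq> 0"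
    if q: "q \<in> ball p (r / 2)" and t: "t \<in> {-T..T}" and nz: "f (\<phi>1 t q) \<noteq> 0" for t q
  proof -
    let ?y = "\<phi>1 t q" and ?z = "\<phi>2 t q"
    have in_cball: "q \<in> cball p r" "?y \<in> cball p r" "?z \<in> cball p r"
      using q r subsetD[OF sb \<phi>1(3)[OF q, of t]] subsetD[OF sb \<phi>2(3)[OF q, of t]] t T by auto
    have fq: "f q \<noteq> 0" using disp1[OF q t] nz by auto
    have "\<bar>cross2 (v1 ?y - v1 q) (v2 ?z)\<bar> \<le> (L1 * (2 * T * M * \<bar>f q\<bar>)) * M"
      using L1(2)[OF in_cball(2,1)] mult_left_mono[OF disp1[OF q t] L1(1)] v2M[OF in_cball(3)] L1(1) T(1) M
      by (intro order_trans[OF abs_cross2_le] mult_mono) auto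
    moreover have "\<bar>cross2 (v1 q) (v2 ?z - v2 q)\<bar> \<le> M * (L2 * (2 * T * M * \<bar>f q\<bar>))"
      using L2(2)[OF in_cball(3,1)] mult_left_mono[OF disp2[OF q t] L2(1)] v1M[OF in_cball(1)] L2(1) T(1) M
      by (intro order_trans[OF abs_cross2_le] mult_mono) auto
    ultimately have "\<bar>cross2 (v1 ?y) (v2 ?z) - cross2 (v1 q) (v2 q)\<bar> \<le> (T * C) * \<bar>f q\<bar>"
      unfolding cross2_diff C_def by (intro order_trans[OF abs_triangle_ineq]) (simp add: algebra_simps)
    also have "\<dots> < \<delta> * \<bar>f q\<bar>" using T(5) fq by simp
    also have "\<dots> \<le> \<bar>cross2 (v1 q) (v2 q)\<bar>" by (rule \<delta>(2)[OF in_cball(1)])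
    finally show ?thesis by auto
  qed
  have sm: "smooth_on ({-T<..<T} \<times> ball p (r / 2)) (\<lambda>(t, q). \<phi>1 t q)"
    "smooth_on ({-T<..<T} \<times> ball p (r / 2)) (\<lambda>(t, q). \<phi>2 t q)"
    unfolding smooth_on_def
    by (intro allI td_subset[OF \<phi>1(1)[unfolded smooth_on_def, THEN spec]]
        td_subset[OF \<phi>2(1)[unfolded smooth_on_def, THEN spec]]; use T in auto)+
  show ?thesis
    using T(1) sm \<phi>1(2) \<phi>2(2)
    by (intro exI[of _ T] exI[of _ \<phi>1] exI[of _ \<phi>2] conjI ballI impI \<phi>1(3,4) \<phi>2(3,4) transv)
      (use T in auto)
qed

section \<open>Quadratic forms and matrices of order two\<close>

lemma quadratic_form_2:
  fixes N :: "real^2^2"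
  shows "w \<bullet> (N *v w) = N$1$1 * (w$1)\<^sup>2 + (N$1$2 + N$2$1) * (w$1 * w$2) + N$2$2 * (w$2)\<^sup>2"
  by (simp add: inner_vec_def matrix_vector_mult_def sum_2 power2_eq_square algebra_simps)

lemma inner_transpose_mult: "x \<bullet> (transpose A *v y) = (A *v x) \<bullet> y" for A :: "real^'n^'m"
  by (metis dot_lmul_matrix inner_commute transpose_matrix_vector)

lemma matrix_inv_works:
  fixes A :: "real^'n^'n"
  assumes "invertible A"
  shows "A ** matrix_inv A = mat 1" "matrix_inv A ** A = mat 1"
  using someI_ex[OF assms[unfolded invertible_def]] by (auto simp: matrix_inv_def)

text \<open>
  If \<open>h\<close> expresses the quadratic form of \<open>S\<close> in the coordinates \<open>L z\<close>, it is the quadratic form of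
  \<open>N = L\<^sup>-\<^sup>T S L\<^sup>-\<^sup>1\<close> and its coefficients are read off from three values. Passing from
  \<open>N\<close> to its symmetric part, whose determinant is minus the discriminant, lowers the determinant by
  \<open>((N\<^sub>1\<^sub>2 - N\<^sub>2\<^sub>1) / 2)\<^sup>2\<close>; hence the inequality.
\<close>

lemma quadratic_form_from_values:
  fixes S L :: "real^2^2" and h :: "real^2 \<Rightarrow> real"
  assumes L: "det L \<noteq> 0" and h: "\<And>z. z \<noteq> 0 \<Longrightarrow> z \<bullet> (S *v z) = h (L *v z)"
  defines "a \<equiv> h (vector [1, 0])" and "c \<equiv> h (vector [0, 1])"
  defines "b \<equiv> (h (vector [1, 1]) - a - c) / 2"
  shows "z \<bullet> (S *v z) = a * ((L *v z)$1)\<^sup>2 + 2 * b * ((L *v z)$1 * (L *v z)$2) + c * ((L *v z)$2)\<^sup>2"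
    and "b\<^sup>2 - a * c \<ge> - (det S / (det L)\<^sup>2)"
proof -
  define P where "P = matrix_inv L"
  define N where "N = transpose P ** S ** P"
  have inv: "invertible L" using L by (simp add: invertible_det_nz)
  have PL: "P ** L = mat 1" and LP: "L ** P = mat 1"
    unfolding P_def using matrix_inv_works[OF inv] by simp_all
  have P1: "P *v (L *v w) = w" and P2: "L *v (P *v w) = w" for w
    by (simp_all add: matrix_vector_mul_assoc PL LP)
  have N: "w \<bullet> (N *v w) = (P *v w) \<bullet> (S *v (P *v w))" for w
    unfolding N_def matrix_vector_mul_assoc[symmetric] inner_transpose_mult ..
  have Nh: "w \<bullet> (N *v w) = h w" if "w \<noteq> 0" for w
  proof -
    have "P *v w \<noteq> 0" using P2[of w] that by auto
    then show ?thesis using h[of "P *v w"] by (simp add: N P2)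
  qed
  have nz: "vector [1, 0] \<noteq> (0::real^2)" "vector [0, 1] \<noteq> (0::real^2)" "vector [1, 1] \<noteq> (0::real^2)"
    by (simp_all add: vec_eq_iff forall_2)
  have abc: "a = N$1$1" "c = N$2$2" "2 * b = N$1$2 + N$2$1"
    unfolding a_def b_def c_def Nh[OF nz(1), symmetric] Nh[OF nz(2), symmetric] Nh[OF nz(3), symmetric]
    by (simp_all add: quadratic_form_2)
  show "z \<bullet> (S *v z) = a * ((L *v z)$1)\<^sup>2 + 2 * b * ((L *v z)$1 * (L *v z)$2) + c * ((L *v z)$2)\<^sup>2"
    using N[of "L *v z"] unfolding P1 quadratic_form_2[of _ N] abc by simp
  have "det P * det L = 1" using arg_cong[OF PL, of det] by (simp add: det_mul)
  then have "det P = 1 / det L" using L by (simp add: field_simps)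
  then have "det N = det S / (det L)\<^sup>2"
    unfolding N_def by (simp add: det_mul power2_eq_square)
  moreover have "b\<^sup>2 - a * c = - det N + ((N$1$2 - N$2$1) / 2)\<^sup>2"
  proof -
    have "b = (N$1$2 + N$2$1) / 2" using abc(3) by simp
    then show ?thesis
      unfolding abc(1,2) by (simp only: det_2 power2_eq_square) (simp add: field_simps)
  qed
  ultimately show "b\<^sup>2 - a * c \<ge> - (det S / (det L)\<^sup>2)" by simp
qed

lemma matrix_inv_2:
  fixes A :: "real^2^2"
  assumes "det A \<noteq> 0"
  shows "matrix_inv A = inverse (det A) *\<^sub>R vector [vector [A$2$2, - A$1$2], vector [- A$2$1, A$1$1]]"
    (is "_ = ?B")
proof -
  have inv: "invertible A" using assms by (simp add: invertible_det_nz)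
  define d where "d = det A"
  have "inverse d * (A$1$1 * A$2$2 - A$1$2 * A$2$1) = 1"
    using assms by (simp add: d_def det_2)
  then have "?B ** A = mat 1"
    unfolding d_def[symmetric]
    by (simp add: vec_eq_iff forall_2 matrix_matrix_mult_def sum_2 mat_def algebra_simps)
  then have "matrix_inv A = (?B ** A) ** matrix_inv A" by simp
  also have "\<dots> = ?B ** (A ** matrix_inv A)" by (simp only: matrix_mul_assoc)
  finally show ?thesis using matrix_inv_works(1)[OF inv] by simp
qed

text \<open>
  Injectivity makes the Gram matrix invertible; the sign is the Cauchy-Schwarz inequality for the columns.
\<close>

lemma gram_det_pos:
  fixes A :: "real^2^3"
  assumes inj: "\<And>w. A *v w = 0 \<Longrightarrow> w = 0"
  shows "det (transpose A ** A) > 0"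
proof -
  have "w = 0" if "(transpose A ** A) *v w = 0" for w
  proof -
    have "(A *v w) \<bullet> (A *v w) = 0"
      using that inner_transpose_mult[of w A "A *v w"] by (simp add: matrix_vector_mul_assoc)
    then show ?thesis using inj by simp
  qed
  then have "det (transpose A ** A) \<noteq> 0"
    using matrix_left_invertible_ker[of "transpose A ** A"] invertible_left_inverse invertible_det_nz by blast
  moreover have "det (transpose A ** A) \<ge> 0"
  proof -
    have "(transpose A ** A)$i$j = column i A \<bullet> column j A" for i j
      by (simp add: matrix_matrix_mult_def transpose_def column_def inner_vec_def)
    then show ?thesis
      using Cauchy_Schwarz_ineq[of "column 1 A" "column 2 A"]
      by (simp add: det_2 power2_eq_square inner_commute)
  qed
  ultimately show ?thesis by linarith
qed

lemma td_matrix_mult_entry: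
  fixes A :: "'a::real_normed_vector \<Rightarrow> real^'n^'m" and B :: "'a \<Rightarrow> real^'k^'n"
  assumes S: "open S" and "\<And>i j. td n S (\<lambda>x. A x $ i $ j)" "\<And>i j. td n S (\<lambda>x. B x $ i $ j)"
  shows "td n S (\<lambda>x. (A x ** B x) $ i $ j)"
  unfolding matrix_matrix_mult_def using assms(2,3)
  by (auto intro!: td_sum[OF S] td_mult[OF S])

section \<open>The factorization of the Jacobian through a tangent moving basis\<close>

context
  fixes U :: "(real^2) set" and x :: "real^2 \<Rightarrow> real^3" and \<Omega> :: "real^2 \<Rightarrow> real^2^3"
  assumes U: "open U" and x: "smooth_on U x" and tmb: "tangent_moving_basis U x \<Omega>"
begin

lemma frechet_derivative_eq_D: "q \<in> U \<Longrightarrow> frechet_derivative x (at q) v = D x q *v v"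
proof -
  assume "q \<in> U"
  then have "x differentiable (at q)"
    using x unfolding smooth_on_def by (metis times_differentiable_on.simps(2))
  then show ?thesis using jacobian_works frechet_derivative_at by metis
qed

lemma tmb_injective:
  assumes q: "q \<in> U" and 0: "\<Omega> q *v w = 0"
  shows "w = 0"
proof -
  have "w$1 *\<^sub>R column 1 (\<Omega> q) + w$2 *\<^sub>R column 2 (\<Omega> q) = 0"
    using 0 by (simp add: matrix_mult_sum sum_2 scalar_mult_eq_scaleR)
  then show ?thesis
    using lin_indep_pair_combination_zero[of "column 1 (\<Omega> q)" "column 2 (\<Omega> q)" "w$1" "w$2"] tmb q
    by (auto simp: tangent_moving_basis_def vec_eq_iff forall_2)
qed

lemma gram_tmb_pos: "q \<in> U \<Longrightarrow> det (transpose (\<Omega> q) ** \<Omega> q) > 0"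
  by (rule gram_det_pos) (rule tmb_injective)

text \<open>
  The span condition gives \<open>Dx = \<Omega> N\<close> for some \<open>N\<close>, and the formula defining \<open>\<Lambda>\<close> recovers
  \<open>N\<^sup>T\<close>.
\<close>

lemma D_eq_tmb_mult_Lambda:
  assumes q: "q \<in> U"
  shows "D x q = \<Omega> q ** transpose (Lambda x \<Omega> q)"
proof -
  let ?G = "transpose (\<Omega> q) ** \<Omega> q"
  have "\<exists>m. column j (D x q) = \<Omega> q *v m" for j
  proof -
    have "column j (D x q) \<in> span {column 1 (\<Omega> q), column 2 (\<Omega> q)}"
      using tmb q exhaust_2[of j] by (auto simp: tangent_moving_basis_def)
    then obtain s t where "column j (D x q) = s *\<^sub>R column 1 (\<Omega> q) + t *\<^sub>R column 2 (\<Omega> q)"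
      unfolding span_insert span_singleton by (auto simp: algebra_simps)
    then have "column j (D x q) = \<Omega> q *v vector [s, t]"
      by (simp add: matrix_mult_sum sum_2 scalar_mult_eq_scaleR)
    then show ?thesis ..
  qed
  then obtain m where m: "\<And>j. column j (D x q) = \<Omega> q *v m j" by metis
  define N where "N = (\<chi> i j. m j $ i)"
  have N: "D x q = \<Omega> q ** N"
  proof -
    have "D x q $ i $ j = (\<Omega> q ** N) $ i $ j" for i j
      using m[of j] by (simp add: vec_eq_iff column_def N_def matrix_matrix_mult_def matrix_vector_mult_def)
    then show ?thesis by (simp add: vec_eq_iff)
  qed
  have inv: "invertible ?G" using gram_tmb_pos[OF q] by (simp add: invertible_det_nz)
  have "Lambda x \<Omega> q = transpose N ** (?G ** matrix_inv ?G)"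
    unfolding Lambda_def N matrix_transpose_mul by (simp only: matrix_mul_assoc)
  also have "\<dots> = transpose N" by (simp add: matrix_inv_works(1)[OF inv])
  finally show ?thesis using N by simp
qed

text \<open>
  As \<open>\<Omega> q\<close> is injective, \<open>Dx = \<Omega> \<Lambda>\<^sup>T\<close> is injective exactly when \<open>\<Lambda>\<close> is invertible.
\<close>

lemma regular_iff_det_Lambda: "q \<in> regular_points U x \<longleftrightarrow> q \<in> U \<and> det (Lambda x \<Omega> q) \<noteq> 0"
proof (cases "q \<in> U")
  case True
  let ?T = "transpose (Lambda x \<Omega> q)"
  have "frechet_derivative x (at q) v = \<Omega> q *v (?T *v v)" for v
    by (simp only: frechet_derivative_eq_D[OF True] D_eq_tmb_mult_Lambda[OF True] matrix_vector_mul_assoc)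
  then have "frechet_derivative x (at q) = (\<lambda>v. \<Omega> q *v (?T *v v))" by (rule ext)
  moreover have "inj ((*v) (\<Omega> q))"
    using tmb_injective[OF True] by (simp add: vec.inj_iff_eq_0)
  ultimately have "inj (frechet_derivative x (at q)) \<longleftrightarrow> inj ((*v) ?T)"
    by (simp only: inj_def) metis
  also have "\<dots> \<longleftrightarrow> det ?T \<noteq> 0"
    using det_nz_iff_inj[of "(*v) ?T"] by simp
  finally show ?thesis using True by (simp add: regular_points_def singularities_def det_transpose)
qed (simp add: regular_points_def)

lemma td_D_entry: "td n U (\<lambda>q. D x q $ i $ j)"
proof -
  have "td n U (\<lambda>q. frechet_derivative x (at q) (axis j 1))"
    using x unfolding smooth_on_def by (metis times_differentiable_on.simps(2))
  from td_vec_nth[OF U this, of i] show ?thesis by (simp add: jacobian_def matrix_def)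
qed

lemma td_tmb: "td n U \<Omega>"
  using tmb by (simp add: tangent_moving_basis_def smooth_on_def)

lemma td_Lambda_entry: "td n U (\<lambda>q. Lambda x \<Omega> q $ i $ j)"
proof -
  let ?G = "\<lambda>q. transpose (\<Omega> q) ** \<Omega> q"
  have \<Omega>: "td n U (\<lambda>q. \<Omega> q $ i $ j)" for i j
    by (intro td_vec_nth U td_tmb)
  have G: "td n U (\<lambda>q. ?G q $ i $ j)" for i j
    by (intro td_matrix_mult_entry U) (simp_all add: transpose_def \<Omega>)
  have d: "td n U (\<lambda>q. inverse (det (?G q)))"
    using gram_tmb_pos by (intro td_inverse U) (fastforce simp: det_2 intro!: td_diff td_mult U G)+
  have eq: "matrix_inv (?G q) $ i $ j =
      (inverse (det (?G q)) *\<^sub>R vector [vector [?G q $2$2, - ?G q $1$2], vector [- ?G q $2$1, ?G q $1$1]]) $ i $ j"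
    if "q \<in> U" for q i j
    by (subst matrix_inv_2) (use gram_tmb_pos[OF that] in auto)
  have inv: "td n U (\<lambda>q. matrix_inv (?G q) $ i $ j)" for i j
  proof (subst td_cong[OF U eq])
    show "td n U (\<lambda>q. (inverse (det (?G q)) *\<^sub>R vector [vector [?G q $2$2, - ?G q $1$2],
        vector [- ?G q $2$1, ?G q $1$1]] :: real^2^2) $ i $ j)"
      using exhaust_2[of i] exhaust_2[of j] by (auto intro!: td_mult U d G td_minus)
  qed
  show ?thesis
    unfolding Lambda_def
    by (intro td_matrix_mult_entry U inv) (simp_all add: transpose_def \<Omega> td_D_entry)
qed

lemma first_form_eq:
  assumes q: "q \<in> U"
  shows "z \<bullet> (first_form x q *v z) = (norm (\<Omega> q *v (transpose (Lambda x \<Omega> q) *v z)))\<^sup>2"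
    and "det (first_form x q) = (det (Lambda x \<Omega> q))\<^sup>2 * det (transpose (\<Omega> q) ** \<Omega> q)"
proof -
  show "z \<bullet> (first_form x q *v z) = (norm (\<Omega> q *v (transpose (Lambda x \<Omega> q) *v z)))\<^sup>2"
    unfolding first_form_def matrix_vector_mul_assoc[symmetric] inner_transpose_mult
    unfolding D_eq_tmb_mult_Lambda[OF q] matrix_vector_mul_assoc[symmetric]
    by (simp add: power2_norm_eq_inner)
  have "first_form x q = Lambda x \<Omega> q ** (transpose (\<Omega> q) ** \<Omega> q) ** transpose (Lambda x \<Omega> q)"
    unfolding first_form_def D_eq_tmb_mult_Lambda[OF q] matrix_transpose_mul
    by (simp add: matrix_mul_assoc)
  then show "det (first_form x q) = (det (Lambda x \<Omega> q))\<^sup>2 * det (transpose (\<Omega> q) ** \<Omega> q)"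
    by (simp add: det_mul power2_eq_square)
qed

end

section \<open>The second fundamental form across singularities\<close>

text \<open>
  Multiplying the extended normal curvature by \<open>\<parallel>\<Omega> w\<parallel>\<^sup>2\<close> gives a function \<open>h w q\<close>, smooth in \<open>q\<close>, which
  at regular points is the second fundamental form in the coordinates \<open>w = \<Lambda>\<^sup>T z\<close>; its values at three
  vectors give the coefficients. At regular points the lower bound for the discriminant is
  \<open>- det II / (det \<Lambda>)\<^sup>2 = - K det (\<Omega>\<^sup>T \<Omega>)\<close>. It extends to \<open>U\<close> because an open set on which it failed
  would consist of singular points.
\<close>

lemma asymptotic_form:
  assumes U: "open U" and x: "proper_frontal U x" and tmb: "tangent_moving_basis U x \<Omega>"
    and ext: "normal_curvature_extends U x \<Omega>"
    and K: "smooth_extension (regular_points U x) (gauss_curvature x \<Omega>) U K"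
    and neg: "\<And>q. q \<in> U \<Longrightarrow> K q < 0"
  obtains a b c where "smooth_on U a" "smooth_on U b" "smooth_on U c"
    and "\<And>q. q \<in> U \<Longrightarrow> a q * c q < (b q)\<^sup>2"
    and "\<And>q z w. q \<in> regular_points U x \<Longrightarrow> w = transpose (Lambda x \<Omega> q) *v z \<Longrightarrow>
      z \<bullet> (second_form x \<Omega> q *v z) = a q * (w$1)\<^sup>2 + 2 * b q * (w$1 * w$2) + c q * (w$2)\<^sup>2"
proof -
  have sx: "smooth_on U x" using x by (simp add: proper_frontal_def frontal_def)
  note ctx = U sx tmb
  obtain k where k: "smooth_on (U \<times> (UNIV - {0})) k"
    and k_eq: "\<And>q w. q \<in> regular_points U x \<Longrightarrow> w \<noteq> 0 \<Longrightarrow>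
      k (q, w) = normal_curvature x \<Omega> q (matrix_inv (transpose (Lambda x \<Omega> q)) *v w)"
    using ext unfolding normal_curvature_extends_def smooth_extension_def by fastforce
  define h where "h w q = k (q, w) * ((\<Omega> q *v w) \<bullet> (\<Omega> q *v w))" for w q
  have h: "td n U (h w)" if "w \<noteq> 0" for w n
  proof -
    have lin: "bounded_linear (\<lambda>A :: real^2^3. A *v w)"
      unfolding linear_conv_bounded_linear[symmetric]
      by (intro linearI) (simp_all add: matrix_vector_mult_add_rdistrib scaleR_matrix_vector_assoc)
    have \<Omega>: "td n U (\<lambda>q. \<Omega> q *v w)"
      by (rule td_bounded_linear[OF U lin td_tmb[OF ctx]])
    have "td n U (\<lambda>q. k (q, w))"
      using k that unfolding smooth_on_def
      by (intro td_compose[OF U, where f=k and g="\<lambda>q. (q, w)" and T="U \<times> (UNIV - {0})"]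
          td_Pair td_id td_const U) auto
    then show ?thesis unfolding h_def
      by (intro td_mult U td_bilinear[OF U bounded_bilinear_inner] \<Omega>)
  qed
  have hz: "z \<bullet> (second_form x \<Omega> q *v z) = h (transpose (Lambda x \<Omega> q) *v z) q"
    if q: "q \<in> regular_points U x" and "z \<noteq> 0" for q z
  proof -
    let ?T = "transpose (Lambda x \<Omega> q)"
    have qU: "q \<in> U" and "det ?T \<noteq> 0"
      using q regular_iff_det_Lambda[OF ctx] by (auto simp: det_transpose)
    then have inv: "invertible ?T" by (simp add: invertible_det_nz)
    have z: "matrix_inv ?T *v (?T *v z) = z"
      by (simp only: matrix_vector_mul_assoc matrix_inv_works[OF inv] matrix_vector_mul_lid)
    then have Tz: "?T *v z \<noteq> 0" using \<open>z \<noteq> 0\<close> by (metis matrix_vector_mult_0_right)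
    then have "\<Omega> q *v (?T *v z) \<noteq> 0" using tmb_injective[OF ctx qU] by blast
    then show ?thesis
      unfolding h_def k_eq[OF q Tz] z normal_curvature_def first_form_eq(1)[OF ctx qU]
      by (simp add: power2_norm_eq_inner)
  qed
  define a where "a = h (vector [1, 0])"
  define c where "c = h (vector [0, 1])"
  define b where "b q = (h (vector [1, 1]) q - a q - c q) / 2" for q
  have nz: "vector [1, 0] \<noteq> (0::real^2)" "vector [0, 1] \<noteq> (0::real^2)" "vector [1, 1] \<noteq> (0::real^2)"
    by (simp_all add: vec_eq_iff forall_2)
  have ta: "td n U a" and tc: "td n U c" for n unfolding a_def c_def by (intro h nz)+
  have tb: "td n U b" for n
    unfolding b_def by (intro td_bounded_linear[OF U bounded_linear_divide] td_diff U h nz ta tc)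
  let ?g = "\<lambda>q. det (transpose (\<Omega> q) ** \<Omega> q)"
  have disc_regular: "(b q)\<^sup>2 - a q * c q \<ge> - (K q * ?g q)" if q: "q \<in> regular_points U x" for q
  proof -
    have qU: "q \<in> U" and d: "det (Lambda x \<Omega> q) \<noteq> 0"
      using q regular_iff_det_Lambda[OF ctx] by auto
    have "K q = gauss_curvature x \<Omega> q"
      using K q by (simp add: smooth_extension_def)
    then have "K q * ?g q = det (second_form x \<Omega> q) / (det (transpose (Lambda x \<Omega> q)))\<^sup>2"
      unfolding gauss_curvature_def first_form_eq(2)[OF ctx qU] det_transpose
      using gram_tmb_pos[OF ctx qU] by simp
    then show ?thesis
      using quadratic_form_from_values(2)[where L="transpose (Lambda x \<Omega> q)"
          and S="second_form x \<Omega> q" and h="\<lambda>w. h w q", OF _ hz[OF q]] d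
      by (simp add: a_def b_def c_def det_transpose)
  qed
  define m where "m q = (b q)\<^sup>2 - a q * c q + K q * ?g q" for q
  have "continuous_on U \<Omega>"
    by (rule td_imp_continuous_on[OF td_tmb[OF ctx]])
  then have "continuous_on U ?g"
    unfolding det_2 matrix_matrix_mult_def transpose_def by (auto intro!: continuous_intros)
  moreover have "continuous_on U K"
    using K by (auto simp: smooth_extension_def smooth_on_def intro: td_imp_continuous_on)
  ultimately have mc: "continuous_on U m"
    unfolding m_def using ta tb tc by (intro continuous_intros) (auto intro: td_imp_continuous_on)
  have m: "m q \<ge> 0" if "q \<in> U" for q
  proof (rule ccontr)
    assume "\<not> m q \<ge> 0"
    have "open (m -` {..<0} \<inter> U)"
      using continuous_on_open_vimage[OF U, THEN iffD1, OF mc] open_lessThan by blast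
    moreover have "m -` {..<0} \<inter> U \<subseteq> singularities U x"
      using disc_regular unfolding m_def regular_points_def by fastforce
    ultimately have "m -` {..<0} \<inter> U \<subseteq> interior (singularities U x)"
      by (rule interior_maximal[rotated])
    moreover have "q \<in> m -` {..<0} \<inter> U" using \<open>\<not> m q \<ge> 0\<close> that by simp
    ultimately show False using x unfolding proper_frontal_def by blast
  qed
  show thesis
  proof (rule that)
    show "smooth_on U a" "smooth_on U b" "smooth_on U c"
      using ta tb tc by (auto simp: smooth_on_def)
    show "a q * c q < (b q)\<^sup>2" if q: "q \<in> U" for q
      using m[OF q] mult_neg_pos[OF neg[OF q] gram_tmb_pos[OF ctx q]] unfolding m_def by linarith
    show "z \<bullet> (second_form x \<Omega> q *v z) = a q * (w$1)\<^sup>2 + 2 * b q * (w$1 * w$2) + c q * (w$2)\<^sup>2"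
      if q: "q \<in> regular_points U x" and w: "w = transpose (Lambda x \<Omega> q) *v z" for q z w
      using quadratic_form_from_values(1)[where L="transpose (Lambda x \<Omega> q)"
          and S="second_form x \<Omega> q" and h="\<lambda>w. h w q", OF _ hz[OF q], of z]
        q regular_iff_det_Lambda[OF ctx]
      unfolding a_def b_def c_def w by (simp add: det_transpose)
  qed
qed

section \<open>Asymptotic curves\<close>

text \<open>
  The matrix \<open>adj(A)\<^sup>T\<close> applied to \<open>w\<close>: a multiple of \<open>A\<^sup>-\<^sup>T w\<close> that stays smooth where \<open>A\<close> degenerates.
\<close>

definition adjugate_transpose_mult :: "real^2^2 \<Rightarrow> real^2 \<Rightarrow> real^2" where
  "adjugate_transpose_mult A w = vector [A$2$2 * w$1 - A$2$1 * w$2, A$1$1 * w$2 - A$1$2 * w$1]"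

lemma transpose_adjugate_transpose_mult:
  "transpose A *v adjugate_transpose_mult A w = det A *\<^sub>R w"
  by (simp add: adjugate_transpose_mult_def vec_eq_iff forall_2 matrix_vector_mult_def sum_2
      transpose_def det_2 algebra_simps del: transpose_matrix_vector)

lemma cross2_adjugate_transpose_mult:
  "cross2 (adjugate_transpose_mult A v) (adjugate_transpose_mult A w) = det A * cross2 v w"
  by (simp add: cross2_def adjugate_transpose_mult_def det_2 algebra_simps)

text \<open>
  Where \<open>\<Lambda>\<close> degenerates the velocity vanishes. Elsewhere \<open>\<Lambda>\<^sup>T\<close> maps the velocity to
  \<open>(det \<Lambda>)\<^sup>2 w\<close>, a null vector of the extended form.
\<close>

lemma G_asymptotic_flow_line:
  fixes a b c :: "real^2 \<Rightarrow> real" and w :: "real^2 \<Rightarrow> real^2"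
    and V :: "(real^2) set"
  assumes U: "open U" and x: "smooth_on U x" and tmb: "tangent_moving_basis U x \<Omega>"
    and form: "\<And>q z w. q \<in> regular_points U x \<Longrightarrow> w = transpose (Lambda x \<Omega> q) *v z \<Longrightarrow>
      z \<bullet> (second_form x \<Omega> q *v z) = a q * (w$1)\<^sup>2 + 2 * b q * (w$1 * w$2) + c q * (w$2)\<^sup>2"
    and w: "\<And>q. q \<in> U \<Longrightarrow> a q * (w q$1)\<^sup>2 + 2 * b q * (w q$1 * w q$2) + c q * (w q$2)\<^sup>2 = 0"
    and smooth: "smooth_on ({-e<..<e} \<times> V) (\<lambda>(t, q). \<phi> t q)" and e: "e > 0" and q: "q \<in> V"
    and inU: "\<And>t. t \<in> {-e<..<e} \<Longrightarrow> \<phi> t q \<in> U"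
    and ode: "\<And>t. t \<in> {-e<..<e} \<Longrightarrow> ((\<lambda>t. \<phi> t q) has_vector_derivative
      det (Lambda x \<Omega> (\<phi> t q)) *\<^sub>R adjugate_transpose_mult (Lambda x \<Omega> (\<phi> t q)) (w (\<phi> t q))) (at t)"
  shows "G_asymptotic U x \<Omega> {-e<..<e} (\<lambda>t. \<phi> t q)"
  unfolding G_asymptotic_def
proof (intro conjI ballI)
  show "open_interval {-e<..<e}"
    using e by (auto simp: open_interval_def is_interval_oo)
  show "(\<lambda>t. \<phi> t q) ` {-e<..<e} \<subseteq> U" using inU by auto
  show "smooth_on {-e<..<e} (\<lambda>t. \<phi> t q)"
    unfolding smooth_on_def
  proof
    fix n
    have o: "open {-e<..<e}" by simp
    have "td n {-e<..<e} (\<lambda>t. (\<lambda>(t, q). \<phi> t q) (t, q))"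
      by (rule td_compose[OF o _ smooth[unfolded smooth_on_def, THEN spec] td_Pair[OF o td_id[OF o] td_const[OF o]]])
        (use q in auto)
    then show "td n {-e<..<e} (\<lambda>t. \<phi> t q)" by simp
  qed
  fix t assume t: "t \<in> {-e<..<e}"
  define y where "y = \<phi> t q"
  define d where "d = det (Lambda x \<Omega> y)"
  define z where "z = d *\<^sub>R adjugate_transpose_mult (Lambda x \<Omega> y) (w y)"
  have "vector_derivative (\<lambda>t. \<phi> t q) (at t) = z"
    using vector_derivative_at[OF ode[OF t]] by (simp add: y_def z_def d_def)
  moreover have "z \<bullet> (second_form x \<Omega> y *v z) = 0"
  proof (cases "d = 0")
    case True
    then show ?thesis by (simp add: z_def)
  next
    case False
    have yU: "y \<in> U" using inU[OF t] by (simp add: y_def)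
    then have reg: "y \<in> regular_points U x"
      using False regular_iff_det_Lambda[OF U x tmb] by (simp add: d_def)
    have "d\<^sup>2 *\<^sub>R w y = transpose (Lambda x \<Omega> y) *v z"
      unfolding z_def d_def matrix_vector_mult_scaleR transpose_adjugate_transpose_mult
      by (simp add: power2_eq_square)
    from form[OF reg this] have "z \<bullet> (second_form x \<Omega> y *v z) =
        (d\<^sup>2)\<^sup>2 * (a y * (w y$1)\<^sup>2 + 2 * b y * (w y$1 * w y$2) + c y * (w y$2)\<^sup>2)"
      by (simp add: power2_eq_square algebra_simps)
    then show ?thesis using w[OF yU] by simp
  qed
  ultimately show "vector_derivative (\<lambda>t. \<phi> t q) (at t) \<bullet>
      (second_form x \<Omega> (\<phi> t q) *v vector_derivative (\<lambda>t. \<phi> t q) (at t)) = 0"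
    by (simp add: y_def)
qed

text \<open>
  With \<open>\<beta> = b \<plusminus> sqrt (b\<^sup>2 - a c)\<close>, both \<open>(- \<beta>, a)\<close> and \<open>(c, - \<beta>)\<close> are null vectors of the form
  \<open>a \<omega>\<^sub>1\<^sup>2 + 2 b \<omega>\<^sub>1 \<omega>\<^sub>2 + c \<omega>\<^sub>2\<^sup>2\<close>, since \<open>\<beta>\<^sup>2 - 2 b \<beta> + a c = 0\<close>. Their determinant
  \<open>\<beta>\<^sup>2 - a c\<close> is positive at \<open>p\<close>, and so near \<open>p\<close>, if the sign of the root is that of \<open>b p\<close>. This choice
  covers the cases \<open>a p = 0\<close> and \<open>c p = 0\<close> as well. The radius \<open>r\<close> is such that the determinant exceeds half its
  value at \<open>p\<close> on the closed ball.
\<close>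

theorem theorem5p1:
  fixes U :: "(real^2) set" and x :: "real^2 \<Rightarrow> real^3" and \<Omega> :: "real^2 \<Rightarrow> real^2^3"
    and p :: "real^2" and K :: "real^2 \<Rightarrow> real"
  assumes "open U"
    and "proper_frontal U x"
    and "tangent_moving_basis U x \<Omega>"
    and "p \<in> singularities U x"
    and "normal_curvature_extends U x \<Omega>"
    and "smooth_extension (regular_points U x) (gauss_curvature x \<Omega>) U K"
    and "\<And>q. q \<in> U \<Longrightarrow> K q < 0"
  shows "\<exists>J U1 U2 (\<phi>1 :: real \<Rightarrow> real^2 \<Rightarrow> real^2) (\<phi>2 :: real \<Rightarrow> real^2 \<Rightarrow> real^2).
    open_interval J \<and> 0 \<in> J \<and> open U1 \<and> open U2 \<and> p \<in> U1 \<and> U1 \<subseteq> U2 \<and> U2 \<subseteq> U \<and>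
    (\<forall>t\<in>J. \<forall>q\<in>U1. \<phi>1 t q \<in> U2 \<and> \<phi>2 t q \<in> U2) \<and>
    smooth_on (J \<times> U1) (\<lambda>(t, q). \<phi>1 t q) \<and>
    smooth_on (J \<times> U1) (\<lambda>(t, q). \<phi>2 t q) \<and>
    (\<forall>q\<in>U1. \<phi>1 0 q = q \<and> \<phi>2 0 q = q) \<and>
    (\<forall>q\<in>U1. G_asymptotic U x \<Omega> J (\<lambda>t. \<phi>1 t q) \<and> G_asymptotic U x \<Omega> J (\<lambda>t. \<phi>2 t q)) \<and>
    (\<forall>q\<in>U1. \<forall>t0\<in>J.
       (\<phi>1 t0 q \<in> regular_points U x \<longrightarrow> vector_derivative (\<lambda>t. \<phi>1 t q) (at t0) \<noteq> 0) \<and>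
       (\<phi>2 t0 q \<in> regular_points U x \<longrightarrow> vector_derivative (\<lambda>t. \<phi>2 t q) (at t0) \<noteq> 0) \<and>
       (\<phi>1 t0 q \<in> regular_points U x \<and> \<phi>2 t0 q \<in> regular_points U x \<longrightarrow>
          lin_indep_pair (vector_derivative (\<lambda>t. \<phi>1 t q) (at t0))
                         (vector_derivative (\<lambda>t. \<phi>2 t q) (at t0))))"
proof -
  note U = assms(1) and tmb = assms(3)
  have x: "smooth_on U x" using assms(2) by (simp add: proper_frontal_def frontal_def)
  note ctx = U x tmb
  have pU: "p \<in> U" using assms(4) by (simp add: singularities_def)
  obtain a b c where abc: "smooth_on U a" "smooth_on U b" "smooth_on U c"
    and disc: "\<And>q. q \<in> U \<Longrightarrow> a q * c q < (b q)\<^sup>2"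
    and form: "\<And>q z w. q \<in> regular_points U x \<Longrightarrow> w = transpose (Lambda x \<Omega> q) *v z \<Longrightarrow>
      z \<bullet> (second_form x \<Omega> q *v z) = a q * (w$1)\<^sup>2 + 2 * b q * (w$1 * w$2) + c q * (w$2)\<^sup>2"
    using asymptotic_form[OF assms(1-3,5-7)] by blast
  have td_abc: "td n U a" "td n U b" "td n U c" for n using abc by (auto simp: smooth_on_def)
  define \<sigma> :: real where "\<sigma> = (if b p \<ge> 0 then 1 else -1)"
  define s where "s q = sqrt (b q * b q - a q * c q)" for q
  define \<beta> where "\<beta> q = b q + \<sigma> * s q" for q
  define w1 :: "real^2 \<Rightarrow> real^2" where "w1 q = vector [- \<beta> q, a q]" for q
  define w2 :: "real^2 \<Rightarrow> real^2" where "w2 q = vector [c q, - \<beta> q]" for q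
  define f where "f q = det (Lambda x \<Omega> q)" for q
  define v1 where "v1 q = adjugate_transpose_mult (Lambda x \<Omega> q) (w1 q)" for q
  define v2 where "v2 q = adjugate_transpose_mult (Lambda x \<Omega> q) (w2 q)" for q
  have td_s: "td n U s" for n
    unfolding s_def using disc
    by (intro td_sqrt U td_diff td_mult td_abc) (auto simp: power2_eq_square)
  have td_\<beta>: "td n U \<beta>" for n
    unfolding \<beta>_def by (intro td_add td_mult U td_abc td_const td_s)
  have td_w: "td n U (\<lambda>q. w1 q $ i)" "td n U (\<lambda>q. w2 q $ i)" for n i
    unfolding w1_def w2_def by (intro td_vec_nth td_vector2 td_minus U td_\<beta> td_abc)+
  have sm: "smooth_on U f" "smooth_on U v1" "smooth_on U v2"
    unfolding smooth_on_def f_def v1_def v2_def adjugate_transpose_mult_def det_2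
    by (intro allI td_vector2 td_diff td_mult U td_w td_Lambda_entry[OF ctx])+
  have root: "\<beta> q * \<beta> q - 2 * b q * \<beta> q + a q * c q = 0" if "q \<in> U" for q
  proof -
    have "s q * s q = b q * b q - a q * c q"
      using disc[OF that] by (simp add: s_def power2_eq_square)
    moreover have "(\<sigma> * s q) * (\<sigma> * s q) = s q * s q" by (simp add: \<sigma>_def)
    moreover have "\<beta> q * \<beta> q - 2 * b q * \<beta> q + a q * c q =
        (\<sigma> * s q) * (\<sigma> * s q) - b q * b q + a q * c q"
      by (simp add: \<beta>_def algebra_simps)
    ultimately show ?thesis by simp
  qed
  have w1: "a q * (w1 q$1)\<^sup>2 + 2 * b q * (w1 q$1 * w1 q$2) + c q * (w1 q$2)\<^sup>2 = 0" if "q \<in> U" for q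
  proof -
    have "a q * (w1 q$1)\<^sup>2 + 2 * b q * (w1 q$1 * w1 q$2) + c q * (w1 q$2)\<^sup>2
        = a q * (\<beta> q * \<beta> q - 2 * b q * \<beta> q + a q * c q)"
      by (simp add: w1_def power2_eq_square algebra_simps)
    then show ?thesis using root[OF that] by simp
  qed
  have w2: "a q * (w2 q$1)\<^sup>2 + 2 * b q * (w2 q$1 * w2 q$2) + c q * (w2 q$2)\<^sup>2 = 0" if "q \<in> U" for q
  proof -
    have "a q * (w2 q$1)\<^sup>2 + 2 * b q * (w2 q$1 * w2 q$2) + c q * (w2 q$2)\<^sup>2
        = c q * (\<beta> q * \<beta> q - 2 * b q * \<beta> q + a q * c q)"
      by (simp add: w2_def power2_eq_square algebra_simps)
    then show ?thesis using root[OF that] by simp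
  qed
  define \<kappa> where "\<kappa> q = cross2 (w1 q) (w2 q)" for q
  have \<kappa>p: "\<kappa> p > 0"
  proof -
    have "s p > 0" using disc[OF pU] by (simp add: s_def power2_eq_square)
    moreover have "s p * s p = b p * b p - a p * c p"
      using disc[OF pU] by (simp add: s_def power2_eq_square)
    moreover have "\<sigma> * \<sigma> = 1" "\<sigma> * b p \<ge> 0" by (auto simp: \<sigma>_def)
    moreover have "\<kappa> p = b p * b p + 2 * ((\<sigma> * b p) * s p) + (\<sigma> * \<sigma>) * (s p * s p) - a p * c p"
      by (simp add: \<kappa>_def cross2_def w1_def w2_def \<beta>_def algebra_simps)
    ultimately have "\<kappa> p = 2 * (s p * s p) + 2 * ((\<sigma> * b p) * s p)" by simp
    then show ?thesis using \<open>s p > 0\<close> \<open>\<sigma> * b p \<ge> 0\<close> by (simp add: add_pos_nonneg)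
  qed
  define \<delta> where "\<delta> = \<kappa> p / 2"
  have "td 0 U \<kappa>"
    unfolding \<kappa>_def cross2_def by (intro td_diff td_mult U td_w)
  then have "continuous_on U \<kappa>" by (rule td_imp_continuous_on)
  then have "open (\<kappa> -` {\<delta><..} \<inter> U)"
    using continuous_on_open_vimage[OF U] open_greaterThan by blast
  moreover have "p \<in> \<kappa> -` {\<delta><..} \<inter> U" using pU \<kappa>p by (simp add: \<delta>_def)
  ultimately obtain r where r: "r > 0" "cball p r \<subseteq> \<kappa> -` {\<delta><..} \<inter> U"
    using open_contains_cball by blast
  have rU: "cball p r \<subseteq> U" using r(2) by blast
  have \<delta>: "\<delta> > 0" using \<kappa>p by (simp add: \<delta>_def)
  have cross: "cross2 (v1 q) (v2 q) = f q * \<kappa> q" for q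
    by (simp add: v1_def v2_def f_def \<kappa>_def cross2_adjugate_transpose_mult)
  have lower: "\<delta> * \<bar>f q\<bar> \<le> \<bar>cross2 (v1 q) (v2 q)\<bar>" if "q \<in> cball p r" for q
  proof -
    have "\<delta> \<le> \<bar>\<kappa> q\<bar>" using r(2) that by fastforce
    then show ?thesis by (simp add: cross abs_mult mult.commute mult_right_mono)
  qed
  obtain e \<phi>1 \<phi>2 where e: "e > 0"
    and s1: "smooth_on ({-e<..<e} \<times> ball p (r / 2)) (\<lambda>(t, q). \<phi>1 t q)"
    and s2: "smooth_on ({-e<..<e} \<times> ball p (r / 2)) (\<lambda>(t, q). \<phi>2 t q)"
    and start: "\<And>q. q \<in> ball p (r / 2) \<Longrightarrow> \<phi>1 0 q = q \<and> \<phi>2 0 q = q"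
    and stay: "\<And>q t. q \<in> ball p (r / 2) \<Longrightarrow> t \<in> {-e<..<e} \<Longrightarrow> \<phi>1 t q \<in> ball p r \<and> \<phi>2 t q \<in> ball p r"
    and ode1: "\<And>q t. q \<in> ball p (r / 2) \<Longrightarrow> t \<in> {-e<..<e} \<Longrightarrow>
      ((\<lambda>t. \<phi>1 t q) has_vector_derivative f (\<phi>1 t q) *\<^sub>R v1 (\<phi>1 t q)) (at t)"
    and ode2: "\<And>q t. q \<in> ball p (r / 2) \<Longrightarrow> t \<in> {-e<..<e} \<Longrightarrow>
      ((\<lambda>t. \<phi>2 t q) has_vector_derivative f (\<phi>2 t q) *\<^sub>R v2 (\<phi>2 t q)) (at t)"
    and transv: "\<And>q t. q \<in> ball p (r / 2) \<Longrightarrow> t \<in> {-e<..<e} \<Longrightarrow> f (\<phi>1 t q) \<noteq> 0 \<Longrightarrow>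
      cross2 (v1 (\<phi>1 t q)) (v2 (\<phi>2 t q)) \<noteq> 0"
    using transversal_slow_flows[OF sm U rU r(1) \<delta> lower] by blast
  let ?J = "{-e<..<e}"
  have sub: "ball p r \<subseteq> cball p r" "ball p (r / 2) \<subseteq> ball p r" using r(1) by auto
  have G1: "G_asymptotic U x \<Omega> ?J (\<lambda>t. \<phi>1 t q)" and G2: "G_asymptotic U x \<Omega> ?J (\<lambda>t. \<phi>2 t q)"
    if q: "q \<in> ball p (r / 2)" for q
    using stay[OF q] sub(1) rU ode1[OF q] ode2[OF q]
    by (intro G_asymptotic_flow_line[OF ctx form w1 s1 e q] G_asymptotic_flow_line[OF ctx form w2 s2 e q];
        force simp: f_def v1_def v2_def)+
  have nonzero: "f y *\<^sub>R v1 y \<noteq> 0 \<and> f y *\<^sub>R v2 y \<noteq> 0" if "y \<in> ball p r" "y \<in> regular_points U x" for y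
  proof -
    have fy: "f y \<noteq> 0" using that(2) regular_iff_det_Lambda[OF ctx] by (simp add: f_def)
    then have "cross2 (v1 y) (v2 y) \<noteq> 0"
      using lower[of y] sub(1) that(1) \<delta> by (smt (verit) mult_pos_pos subsetD zero_less_abs_iff)
    then show ?thesis using fy by (auto simp: cross2_def)
  qed
  have indep: "lin_indep_pair (f (\<phi>1 t q) *\<^sub>R v1 (\<phi>1 t q)) (f (\<phi>2 t q) *\<^sub>R v2 (\<phi>2 t q))"
    if "q \<in> ball p (r / 2)" "t \<in> ?J" "\<phi>1 t q \<in> regular_points U x" "\<phi>2 t q \<in> regular_points U x" for t q
  proof (rule cross2_nonzero_imp_lin_indep_pair)
    have "f (\<phi>1 t q) \<noteq> 0" "f (\<phi>2 t q) \<noteq> 0"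
      using that(3,4) regular_iff_det_Lambda[OF ctx] by (auto simp: f_def)
    moreover have "cross2 (f (\<phi>1 t q) *\<^sub>R v1 (\<phi>1 t q)) (f (\<phi>2 t q) *\<^sub>R v2 (\<phi>2 t q)) =
        f (\<phi>1 t q) * f (\<phi>2 t q) * cross2 (v1 (\<phi>1 t q)) (v2 (\<phi>2 t q))"
      by (simp add: cross2_def algebra_simps)
    ultimately show "cross2 (f (\<phi>1 t q) *\<^sub>R v1 (\<phi>1 t q)) (f (\<phi>2 t q) *\<^sub>R v2 (\<phi>2 t q)) \<noteq> 0"
      using transv[OF that(1,2)] by simp
  qed
  show ?thesis
  proof (rule exI[of _ ?J], rule exI[of _ "ball p (r / 2)"], rule exI[of _ "ball p r"],
      rule exI[of _ \<phi>1], rule exI[of _ \<phi>2], intro conjI ballI impI s1 s2 G1 G2)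
    show "open_interval ?J" using e by (auto simp: open_interval_def is_interval_oo)
    fix q t assume q: "q \<in> ball p (r / 2)" and t: "t \<in> ?J"
    note vd = vector_derivative_at[OF ode1[OF q t]] vector_derivative_at[OF ode2[OF q t]]
    show "vector_derivative (\<lambda>t. \<phi>1 t q) (at t) \<noteq> 0" if "\<phi>1 t q \<in> regular_points U x"
      unfolding vd using nonzero[OF _ that] stay[OF q t] by blast
    show "vector_derivative (\<lambda>t. \<phi>2 t q) (at t) \<noteq> 0" if "\<phi>2 t q \<in> regular_points U x"
      unfolding vd using nonzero[OF _ that] stay[OF q t] by blast
    show "lin_indep_pair (vector_derivative (\<lambda>t. \<phi>1 t q) (at t)) (vector_derivative (\<lambda>t. \<phi>2 t q) (at t))"
      if "\<phi>1 t q \<in> regular_points U x \<and> \<phi>2 t q \<in> regular_points U x"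
      unfolding vd using indep[OF q t] that by blast
  qed (use e r(1) sub rU start stay in auto)
qed

end
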